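(* Let $\mathfrak{X}$ be a homogeneous tree of degree $q+1$ with $q\ge 2$, with boundary $\Omega$, and let $1\le p<2$. (1) Suppose $f\in L^{p}(\mathfrak{X})$. For $p<r<p'$ and $z\in\mathbb{C}$ with $\operatorname{Im} z=\delta_{r'}$, there exists a constant $C_{p,r}>0$ (depending only on $p$, $r$ and the tree, not on $f$ or $z$) such that $$\left(\int_{\Omega}|\widetilde{f}(z,\omega)|^r\, d\nu(\omega)\right)^{1/r}\le C_{p,r}\,\|f\|_{L^{p}(\mathfrak{X})}.$$ If $p=1$, then this holds for every $r\in[1,\infty]$ (with $\operatorname{Im} z=\delta_{r'}$) with $C_{p,r}=1$. (2) Suppose $f\in L^{p,1}(\mathfrak{X})$. For $r=p$ or $r=p'$ and $z\in\mathbb{C}$ with $\operatorname{Im} z=\delta_{r'}$, there exists a constant $C_{p}>0$ (depending only on $p$ and the tree, not on $f$ or $z$) such that $$\left(\int_{\Omega}|\widetilde{f}(z,\omega)|^r\, d\nu(\omega)\right)^{1/r}\le C_{p}\,\|f\|_{L^{p,1}(\mathfrak{X})}.$$ When $r=\infty$ the left-hand side is read as the $L^\infty(\Omega,\nu)$ norm of $\widetilde f(z,\cdot)$.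
   Context: Tree and boundary: $\mathfrak{X}$ is the homogeneous tree of degree $q+1$ ($q\ge2$ an integer), i.e. the connected graph without loops (cycles) in which every vertex has exactly $q+1$ neighbours; $\mathfrak{X}$ is identified with its vertex set, with counting measure and graph distance $d$. Fix a reference vertex $o$ and write $|x|=d(o,x)$. The boundary $\Omega$ is the set of all infinite geodesic rays $\omega=(\omega_0=o,\omega_1,\omega_2,\dots)$ starting at $o$. $\nu$ is the probability measure on $\Omega$ (with the $\sigma$-algebra generated by the sets $E(x)=\{\omega\in\Omega:\omega_{|x|}=x\}$, $x\in\mathfrak X$) invariant under the isometries of $\mathfrak{X}$ fixing $o$; explicitly $\nu(E(x))=\frac{q}{(q+1)q^{|x|}}$ for $|x|\ge1$. Poisson kernel: for $x\in\mathfrak{X}$, $\omega\in\Omega$, let $c(x,\omega)$ be the last vertex lying on $\omega$ in the geodesic path from $o$ to $x$, let $h_\omega(x)=2|c(x,\omega)|-|x|$, and $p(x,\omega)=q^{h_\omega(x)}$. For $z\in\mathbb{C}$, $p^{1/2+iz}(x,\omega)=q^{(1/2+iz)h_\omega(x)}$. (The kernel $p(x,\omega)$ is not to be confused with the exponent $p$.) Helgason-Fourier transform: for finitely supported $f:\mathfrak{X}\to\mathbb{C}$, $$\widetilde f(z,\omega)=\sum_{x\in\mathfrak{X}}f(x)\,p^{1/2+iz}(x,\omega),\qquad z\in\mathbb{C},\ \omega\in\Omega.$$ For general $f$ in $L^p(\mathfrak{X})$ (resp. $L^{p,1}(\mathfrak{X})$), $\widetilde f(z,\cdot)$ denotes the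 continuous extension of this map from the dense subspace of finitely supported functions; thus the statement is that the inequality holds for all finitely supported $f$ and hence, for the extension, for all $f$ in the space. Exponents: $\frac1p+\frac1{p'}=1$ (with $1'=\infty$, $\infty'=1$); $\delta_p=\frac1p-\frac12$ for $1<p<\infty$, $\delta_1=\frac12$, $\delta_\infty=-\frac12$. Lorentz norm: for $g:\mathfrak{X}\to\mathbb{C}$, $d_g(s)=\#\{x:|g(x)|>s\}$, $g^*(t)=\inf\{s:d_g(s)\le t\}$, and $\|g\|_{L^{p,1}(\mathfrak{X})}=\frac1p\int_0^\infty g^*(t)\,t^{1/p}\,\frac{dt}{t}$; $L^{p,1}(\mathfrak{X})$ is the space of $g$ for which this is finite ($L^{1,1}=L^1$). *)

theory Defs
  imports "HOL-Probability.Probability"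
begin

(* A graph is an adjacency relation on a type of vertices. *)

definition walk_betw :: "('v \<Rightarrow> 'v \<Rightarrow> bool) \<Rightarrow> 'v \<Rightarrow> 'v list \<Rightarrow> 'v \<Rightarrow> bool" where
  "walk_betw adj x xs y \<longleftrightarrow> xs \<noteq> [] \<and> hd xs = x \<and> last xs = y \<and> successively adj xs"

definition is_cycle :: "('v \<Rightarrow> 'v \<Rightarrow> bool) \<Rightarrow> 'v list \<Rightarrow> bool" where
  "is_cycle adj xs \<longleftrightarrow>
     length xs \<ge> 3 \<and> distinct xs \<and> successively adj xs \<and> adj (last xs) (hd xs)"

(* card of an infinite set is 0, so the degree condition includes local finiteness. *)
definition homogeneous_tree :: "nat \<Rightarrow> ('v \<Rightarrow> 'v \<Rightarrow> bool) \<Rightarrow> bool" where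
  "homogeneous_tree q adj \<longleftrightarrow>
     symp adj \<and> irreflp adj \<and>
     (\<forall>x y. \<exists>xs. walk_betw adj x xs y) \<and>
     (\<nexists>xs. is_cycle adj xs) \<and>
     (\<forall>x. card {y. adj x y} = q + 1)"

definition gdist :: "('v \<Rightarrow> 'v \<Rightarrow> bool) \<Rightarrow> 'v \<Rightarrow> 'v \<Rightarrow> nat" where
  "gdist adj x y = (LEAST n. \<exists>xs. walk_betw adj x xs y \<and> length xs = Suc n)"

(* Meaningful when geodesics are unique, as they are in a tree. *)
definition geodesic :: "('v \<Rightarrow> 'v \<Rightarrow> bool) \<Rightarrow> 'v \<Rightarrow> 'v \<Rightarrow> 'v list" where
  "geodesic adj x y = (THE xs. walk_betw adj x xs y \<and> length xs = Suc (gdist adj x y))"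

definition boundary :: "('v \<Rightarrow> 'v \<Rightarrow> bool) \<Rightarrow> 'v \<Rightarrow> (nat \<Rightarrow> 'v) set" where
  "boundary adj v0 = {\<omega>. \<omega> 0 = v0 \<and> (\<forall>i j. i \<le> j \<longrightarrow> gdist adj (\<omega> i) (\<omega> j) = j - i)}"

definition cylinder :: "('v \<Rightarrow> 'v \<Rightarrow> bool) \<Rightarrow> 'v \<Rightarrow> 'v \<Rightarrow> (nat \<Rightarrow> 'v) set" where
  "cylinder adj v0 x = {\<omega> \<in> boundary adj v0. \<omega> (gdist adj v0 x) = x}"

(* The measure on the sigma-algebra generated by the cylinders with the prescribed values there.
   Together with the empty set the cylinders are closed under intersection, so these values
   determine it; they depend on the distance to v0 only, which is its invariance under the
   isometries fixing v0. *)
definition boundary_measure ::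
    "nat \<Rightarrow> ('v \<Rightarrow> 'v \<Rightarrow> bool) \<Rightarrow> 'v \<Rightarrow> (nat \<Rightarrow> 'v) measure" where
  "boundary_measure q adj v0 =
     extend_measure (boundary adj v0) UNIV (cylinder adj v0)
       (\<lambda>x. if x = v0 then 1
            else ennreal (real q / (real (q + 1) * real q ^ gdist adj v0 x)))"

definition confluence :: "('v \<Rightarrow> 'v \<Rightarrow> bool) \<Rightarrow> 'v \<Rightarrow> 'v \<Rightarrow> (nat \<Rightarrow> 'v) \<Rightarrow> 'v" where
  "confluence adj v0 x \<omega> = last (filter (\<lambda>v. v \<in> range \<omega>) (geodesic adj v0 x))"

definition height :: "('v \<Rightarrow> 'v \<Rightarrow> bool) \<Rightarrow> 'v \<Rightarrow> (nat \<Rightarrow> 'v) \<Rightarrow> 'v \<Rightarrow> int" where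
  "height adj v0 \<omega> x = 2 * int (gdist adj v0 (confluence adj v0 x \<omega>)) - int (gdist adj v0 x)"

(* The complex power s of the Poisson kernel. *)
definition poisson_power ::
    "nat \<Rightarrow> ('v \<Rightarrow> 'v \<Rightarrow> bool) \<Rightarrow> 'v \<Rightarrow> complex \<Rightarrow> 'v \<Rightarrow> (nat \<Rightarrow> 'v) \<Rightarrow> complex" where
  "poisson_power q adj v0 s x \<omega> = of_nat q powr (s * of_int (height adj v0 \<omega> x))"

definition finitely_supported :: "('v \<Rightarrow> complex) \<Rightarrow> bool" where
  "finitely_supported f \<longleftrightarrow> finite {x. f x \<noteq> 0}"

(* Only meaningful for finitely supported f. *)
definition helgason_fourier ::
    "nat \<Rightarrow> ('v \<Rightarrow> 'v \<Rightarrow> bool) \<Rightarrow> 'v \<Rightarrow> ('v \<Rightarrow> complex) \<Rightarrow> complex \<Rightarrow> (nat \<Rightarrow> 'v) \<Rightarrow> complex" where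
  "helgason_fourier q adj v0 f z \<omega> =
     (\<Sum>x | f x \<noteq> 0. f x * poisson_power q adj v0 (1/2 + \<i> * z) x \<omega>)"

(* Exponents range over [1,\<infinity>] inside ennreal, where 1/\<infinity> = 0 and 1/0 = \<infinity>. *)
definition conj_exponent :: "ennreal \<Rightarrow> ennreal" where
  "conj_exponent p = inverse (1 - inverse p)"

lemma conj_exponent:
  assumes "1 \<le> p"
  shows "inverse p + inverse (conj_exponent p) = 1"
proof -
  have "inverse p \<le> 1"
    by (metis assms divide_ennreal_def divide_le_posI_ennreal dual_order.strict_trans1
        ennreal_zero_less_one verit_prod_simplify(1,2))
  moreover have "inverse (inverse y) = y" for y :: ennreal
    by (cases y; cases "y = 0") (auto simp: inverse_ennreal less_le)
  ultimately show ?thesis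
    by (simp add: conj_exponent_def)
qed

definition delta :: "ennreal \<Rightarrow> real" where
  "delta p = enn2real (inverse p) - 1/2"

definition Lp_norm :: "'a measure \<Rightarrow> ennreal \<Rightarrow> ('a \<Rightarrow> complex) \<Rightarrow> ennreal" where
  "Lp_norm M r f =
     (if r = \<infinity> then esssup M (\<lambda>x. ennreal (norm (f x)))
      else let I = \<integral>\<^sup>+x. ennreal (norm (f x) powr enn2real r) \<partial>M
           in if I = \<infinity> then \<infinity> else ennreal (enn2real I powr (1 / enn2real r)))"

definition Lp_space :: "'a measure \<Rightarrow> ennreal \<Rightarrow> ('a \<Rightarrow> complex) set" where
  "Lp_space M r = {f \<in> borel_measurable M. Lp_norm M r f < \<infinity>}"

definition distr_fun :: "('v \<Rightarrow> complex) \<Rightarrow> ennreal \<Rightarrow> ennreal" where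
  "distr_fun g s = emeasure (count_space UNIV) {x. ennreal (norm (g x)) > s}"

definition decr_rearr :: "('v \<Rightarrow> complex) \<Rightarrow> real \<Rightarrow> ennreal" where
  "decr_rearr g t = Inf {s. distr_fun g s \<le> ennreal t}"

definition lorentz_norm :: "real \<Rightarrow> ('v \<Rightarrow> complex) \<Rightarrow> ennreal" where
  "lorentz_norm p g =
     ennreal (1 / p) * (\<integral>\<^sup>+t\<in>{0<..}. (decr_rearr g t * ennreal (t powr (1 / p) / t)) \<partial>lborel)"

definition lorentz_space :: "real \<Rightarrow> ('v \<Rightarrow> complex) set" where
  "lorentz_space p = {g. lorentz_norm p g < \<infinity>}"

(* T is the continuous extension of the transform at z, from the finitely supported functions to
   the space S with norm N, as a map into L^r of the boundary. Elements of L^r are represented by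
   functions, so agreement is almost everywhere. *)
definition helgason_fourier_extension ::
    "nat \<Rightarrow> ('v \<Rightarrow> 'v \<Rightarrow> bool) \<Rightarrow> 'v \<Rightarrow> complex \<Rightarrow> ('v \<Rightarrow> complex) set \<Rightarrow>
     (('v \<Rightarrow> complex) \<Rightarrow> ennreal) \<Rightarrow> ennreal \<Rightarrow>
     (('v \<Rightarrow> complex) \<Rightarrow> (nat \<Rightarrow> 'v) \<Rightarrow> complex) \<Rightarrow> bool" where
  "helgason_fourier_extension q adj v0 z S N r T \<longleftrightarrow>
     (let \<nu> = boundary_measure q adj v0 in
       (\<forall>f\<in>S. T f \<in> Lp_space \<nu> r) \<and>
       (\<forall>f\<in>S. finitely_supported f \<longrightarrow> (AE \<omega> in \<nu>. T f \<omega> = helgason_fourier q adj v0 f z \<omega>)) \<and>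
       (\<forall>f\<in>S. \<forall>\<phi>. (\<forall>n. \<phi> n \<in> S) \<and> (\<lambda>n. N (\<lambda>x. \<phi> n x - f x)) \<longlonglongrightarrow> 0 \<longrightarrow>
          (\<lambda>n. Lp_norm \<nu> r (\<lambda>\<omega>. T (\<phi> n) \<omega> - T f \<omega>)) \<longlonglongrightarrow> 0))"

end

theory Submission
  imports Defs
begin

text \<open>
  Why the estimates hold. On the line \<open>Im z = \<delta>\<^sub>r\<^sub>'\<close> the kernel has absolute value \<open>q\<close> to the power
  \<open>h / r\<close>, where \<open>h\<close> is the height, whatever the real part of \<open>z\<close>. It suffices to bound the
  positive operator with this kernel, uniformly on finitely supported functions. For \<open>p = 1\<close> and
  finite \<open>r\<close>, the \<open>r\<close>-th power of the absolute value is the Poisson kernel itself, and summation by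
  parts writes it as a combination of indicators of cylinders with nonnegative coefficients; this
  shows that the norm in \<open>L\<^sup>r(\<Omega>)\<close> is at most 1 (\<open>Lp_norm_kernel_le_1\<close>), and the triangle inequality
  does the rest.

  In general it is enough to treat the characteristic function of a finite set \<open>F\<close> of \<open>m\<close> vertices,
  because a finitely supported function is dominated by a sum over its dyadic level sets
  (\<open>dyadic_bound\<close>). Such a sum is controlled by the norm of \<open>L\<^sup>P\<^sup>,\<^sup>1\<close>, and also by that of \<open>L\<^sup>p\<close> for
  every \<open>p < P\<close>, as the counting measure has no small sets (\<open>dyadic_le_lorentz_norm\<close>,
  \<open>dyadic_le_Lp_norm\<close>).

  For the set \<open>F\<close> the kernel is split by the distance \<open>k\<close> of the vertex to the ray. If the ray
  leaves the geodesic from the root to the vertex at level \<open>j\<close>, the height is \<open>j - k\<close>. So the part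
  for \<open>k\<close> is at most \<open>q\<^sup>-\<^sup>k\<^sup>/\<^sup>r\<close> times the sum over \<open>j\<close> of \<open>q\<^sup>j\<^sup>/\<^sup>r a j\<close>, where \<open>a j\<close> is the number of vertices in
  \<open>F\<close> that are \<open>k\<close> steps below the \<open>j\<close>-th vertex of the ray, and \<open>a j\<close> is at most
  \<open>min (2 q\<^sup>k) m\<close>. The \<open>r\<close>-th power of such a geometrically weighted sum is bounded, up to a
  constant, by the sum of \<open>q\<^sup>j (a j)\<close> times the \<open>(r - 1)\<close>-st power of \<open>min (2 q\<^sup>k) m\<close>
  (\<open>lacunary_sum_powr_le\<close>), and the integral of the sum of \<open>q\<^sup>j (a j)\<close> is at most \<open>m\<close>, since the cylinder of a vertex on level \<open>j\<close> has measure at most \<open>q\<^sup>-\<^sup>j\<close>.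
  So the part for \<open>k\<close> has norm at most a constant times
  \<open>q\<^sup>-\<^sup>k\<^sup>/\<^sup>r (min (2 q\<^sup>k) m)\<^sup>1\<^sup>-\<^sup>1\<^sup>/\<^sup>r m\<^sup>1\<^sup>/\<^sup>r\<close> (\<open>Lp_norm_level_sum_le\<close>), and the sum over \<open>k\<close> of these numbers
  is at most a constant times \<open>m\<^sup>1\<^sup>/\<^sup>P\<close> when \<open>P \<le> r < P'\<close>, or when \<open>r = P' > 2\<close>
  (\<open>level_series_interior\<close>, \<open>level_series_endpoint\<close>). For \<open>r = p < 2\<close> and \<open>r = p'\<close> the choice
  \<open>P = p\<close> gives the Lorentz space estimates if \<open>p > 1\<close>, and the triangle inequality gives them if
  \<open>p = 1\<close>; for \<open>p < r < p'\<close> there is room for some \<open>P > p\<close>, which gives the estimate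
  on \<open>L\<^sup>p\<close>.

  As the bounds concern sums of absolute values, the series that defines the transform converges
  absolutely almost everywhere for every function of finite norm; its sum is the continuous extension
  (\<open>extension_of_positive_bound\<close>).
\<close>

section \<open>Rooted homogeneous trees\<close>

locale rooted_tree =
  fixes q :: nat and adj :: "'v \<Rightarrow> 'v \<Rightarrow> bool" and v0 :: 'v
  assumes q_ge_2: "q \<ge> 2" and tree: "homogeneous_tree q adj"
begin

abbreviation lev :: "'v \<Rightarrow> nat" where
  "lev \<equiv> gdist adj v0"

lemma adj_sym: "adj x y \<Longrightarrow> adj y x"
  using tree by (auto simp: homogeneous_tree_def dest: sympD)

lemma no_cycle: "\<not> is_cycle adj xs"
  using tree by (auto simp: homogeneous_tree_def)

lemma degree: "card {y. adj x y} = q + 1"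
  using tree by (auto simp: homogeneous_tree_def)

lemma finite_neighbours: "finite {y. adj x y}"
  using degree[of x] by (metis card.infinite add_is_0 zero_neq_one)

lemma gdist_attained: "\<exists>xs. walk_betw adj x xs y \<and> length xs = Suc (gdist adj x y)"
proof -
  obtain xs where xs: "walk_betw adj x xs y"
    using tree unfolding homogeneous_tree_def by blast
  then have "length xs = Suc (length xs - 1)"
    by (auto simp: walk_betw_def)
  with xs have "\<exists>n xs. walk_betw adj x xs y \<and> length xs = Suc n"
    by blast
  then show ?thesis
    unfolding gdist_def by (rule LeastI_ex)
qed

lemma gdist_le: "walk_betw adj x xs y \<Longrightarrow> length xs = Suc n \<Longrightarrow> gdist adj x y \<le> n"
  unfolding gdist_def by (rule Least_le) blast

lemma gdist_1_adj:
  assumes "gdist adj x y = 1"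
  shows "adj x y"
proof -
  obtain xs where "walk_betw adj x xs y" "length xs = 2"
    using gdist_attained[of x y] assms by auto
  then show ?thesis
    by (auto simp: walk_betw_def length_Suc_conv numeral_2_eq_2)
qed

lemma lev_root: "lev v0 = 0"
  using gdist_le[of v0 "[v0]" v0 0] by (auto simp: walk_betw_def)

lemma lev_eq_0: "lev x = 0 \<longleftrightarrow> x = v0"
proof
  assume "lev x = 0"
  then obtain xs where "walk_betw adj v0 xs x" "length xs = 1"
    using gdist_attained[of v0 x] by auto
  then show "x = v0"
    by (auto simp: walk_betw_def length_Suc_conv)
qed (simp add: lev_root)

lemma walk_snoc:
  assumes "walk_betw adj x xs y" "adj y z"
  shows "walk_betw adj x (xs @ [z]) z"
  using assms by (auto simp: walk_betw_def successively_append_iff)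

lemma lev_adj_le:
  assumes "adj x y"
  shows "lev y \<le> Suc (lev x)"
proof -
  obtain xs where "walk_betw adj v0 xs x" "length xs = Suc (lev x)"
    using gdist_attained by blast
  then show ?thesis
    using gdist_le[OF walk_snoc[OF _ assms]] by simp
qed

lemma walk_unsnoc:
  assumes "walk_betw adj v0 xs x" "length xs = Suc (Suc n)"
  shows "\<exists>y. walk_betw adj v0 (butlast xs) y \<and> length (butlast xs) = Suc n \<and> adj y x \<and> xs = butlast xs @ [x]"
proof -
  define ys where "ys = butlast xs"
  have "xs \<noteq> []" "last xs = x"
    using assms by (auto simp: walk_betw_def)
  then have ys: "xs = ys @ [x]"
    unfolding ys_def by (metis append_butlast_last_id)
  then have "ys \<noteq> []"
    using assms(2) by auto
  with ys show ?thesis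
    using assms by (intro exI[of _ "last ys"]) (auto simp: walk_betw_def successively_append_iff)
qed

lemma ex_lower_neighbour:
  assumes "lev x = Suc n"
  shows "\<exists>y. adj y x \<and> lev y = n"
proof -
  obtain xs where "walk_betw adj v0 xs x" "length xs = Suc (Suc n)"
    using gdist_attained[of v0 x] assms by auto
  from walk_unsnoc[OF this] obtain y where
    y: "walk_betw adj v0 (butlast xs) y" "length (butlast xs) = Suc n" "adj y x" by blast
  have "lev y \<le> n"
    using gdist_le[OF y(1,2)] .
  with lev_adj_le[OF y(3)] assms y(3) show ?thesis by (intro exI[of _ y]) auto
qed

text \<open>Descending from two vertices of a sphere until the two chains meet gives a path inside the
  ball. A common neighbour of the end points on the next sphere would close a cycle; this is where
  the absence of cycles enters.\<close>

lemma path_in_ball: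
  assumes "lev x = n" "lev y = n" "x \<noteq> y"
  shows "\<exists>xs. distinct xs \<and> successively adj xs \<and> length xs \<ge> 3 \<and> hd xs = x \<and> last xs = y \<and>
           (\<forall>v\<in>set xs. lev v \<le> n)"
  using assms
proof (induction n arbitrary: x y)
  case 0
  then show ?case by (simp add: lev_eq_0)
next
  case (Suc n)
  obtain x' where x': "adj x' x" "lev x' = n"
    using ex_lower_neighbour[OF Suc.prems(1)] by blast
  obtain y' where y': "adj y' y" "lev y' = n"
    using ex_lower_neighbour[OF Suc.prems(2)] by blast
  show ?case
  proof (cases "x' = y'")
    case True
    have "x \<noteq> x'" "y \<noteq> x'"
      using x'(2) Suc.prems(1,2) n_not_Suc_n by metis+
    then show ?thesis
      using True x' y' Suc.prems adj_sym[OF x'(1)] by (intro exI[of _ "[x, x', y]"]) auto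
  next
    case False
    obtain xs where xs: "distinct xs" "successively adj xs" "length xs \<ge> 3" "hd xs = x'"
      "last xs = y'" "\<forall>v\<in>set xs. lev v \<le> n"
      using Suc.IH[OF x'(2) y'(2) False] by blast
    have "x \<notin> set xs" "y \<notin> set xs" "xs \<noteq> []"
      using xs Suc.prems by auto
    then show ?thesis
      using xs x' y' Suc.prems adj_sym[OF x'(1)]
      by (intro exI[of _ "x # xs @ [y]"]) (auto simp: successively_append_iff successively_Cons)
  qed
qed

lemma lower_neighbour_unique:
  assumes "adj x z" "adj y z" "lev z = Suc (lev x)" "lev z = Suc (lev y)"
  shows "x = y"
proof (rule ccontr)
  assume "x \<noteq> y"
  then obtain xs where xs: "distinct xs" "successively adj xs" "length xs \<ge> 3" "hd xs = x"
    "last xs = y" "\<forall>v\<in>set xs. lev v \<le> lev x"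
    using path_in_ball[of x "lev x" y] assms(3,4) by (metis nat.inject)
  have "z \<notin> set xs" "xs \<noteq> []"
    using xs assms by auto
  then have "is_cycle adj (xs @ [z])"
    using xs assms adj_sym[OF assms(1)] by (auto simp: is_cycle_def successively_append_iff)
  then show False
    using no_cycle by blast
qed

definition parent :: "'v \<Rightarrow> 'v" where
  "parent x = (SOME y. adj y x \<and> lev x = Suc (lev y))"

lemma parent:
  assumes "lev x = Suc n"
  shows "adj (parent x) x" "lev (parent x) = n"
proof -
  have "\<exists>y. adj y x \<and> lev x = Suc (lev y)"
    using ex_lower_neighbour[OF assms] assms by auto
  from someI_ex[OF this] assms show "adj (parent x) x" "lev (parent x) = n"
    unfolding parent_def by auto
qed

lemma parent_eqI:
  assumes "adj y x" "lev x = Suc (lev y)"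
  shows "parent x = y"
  using lower_neighbour_unique[OF parent(1) assms(1)] parent(2) assms by auto

abbreviation ancestor :: "nat \<Rightarrow> 'v \<Rightarrow> 'v" where
  "ancestor k x \<equiv> (parent ^^ k) x"

lemma lev_ancestor: "k \<le> lev x \<Longrightarrow> lev (ancestor k x) = lev x - k"
proof (induction k)
  case (Suc k)
  then have "lev (ancestor k x) = Suc (lev x - Suc k)"
    by simp
  then show ?case
    by (simp add: parent(2))
qed simp

lemma ancestor_lev: "ancestor (lev x) x = v0"
  using lev_ancestor[of "lev x" x] by (simp add: lev_eq_0)

subsection \<open>Geodesics and horocyclic heights\<close>

lemma geodesic_walk_unique:
  assumes "walk_betw adj v0 xs x" "length xs = Suc (lev x)"
  shows "xs = map (\<lambda>i. ancestor (lev x - i) x) [0..<Suc (lev x)]"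
  using assms
proof (induction "lev x" arbitrary: x xs)
  case 0
  then show ?case
    by (auto simp: walk_betw_def length_Suc_conv)
next
  case (Suc n)
  obtain y where y: "walk_betw adj v0 (butlast xs) y" "length (butlast xs) = Suc n" "adj y x"
    "xs = butlast xs @ [x]"
    using walk_unsnoc[of xs x n] Suc.prems Suc.hyps by auto
  have "lev y \<le> n"
    using gdist_le[OF y(1,2)] .
  with lev_adj_le[OF y(3)] Suc.hyps have n: "lev y = n"
    by auto
  have py: "parent x = y"
    using parent_eqI[OF y(3)] n Suc.hyps by simp
  have "butlast xs = map (\<lambda>i. ancestor (n - i) y) [0..<Suc n]"
    using Suc.hyps(1)[of y "butlast xs"] n y by simp
  also have "\<dots> = map (\<lambda>i. ancestor (Suc n - i) x) [0..<Suc n]"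
    by (intro map_cong) (auto simp: Suc_diff_le funpow_swap1 py[symmetric])
  finally have eq: "butlast xs = map (\<lambda>i. ancestor (Suc n - i) x) [0..<Suc n]" .
  show ?case
    by (subst y(4), subst eq) (simp add: Suc.hyps(2)[symmetric])
qed

lemma geodesic_root:
  "geodesic adj v0 x = map (\<lambda>i. ancestor (lev x - i) x) [0..<Suc (lev x)]"
  unfolding geodesic_def
proof (rule the_equality)
  show "walk_betw adj v0 (map (\<lambda>i. ancestor (lev x - i) x) [0..<Suc (lev x)]) x \<and>
      length (map (\<lambda>i. ancestor (lev x - i) x) [0..<Suc (lev x)]) = Suc (lev x)"
    using gdist_attained[of v0 x] geodesic_walk_unique by metis
qed (use geodesic_walk_unique in blast)

abbreviation Omega :: "(nat \<Rightarrow> 'v) set" where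
  "Omega \<equiv> boundary adj v0"

abbreviation E :: "'v \<Rightarrow> (nat \<Rightarrow> 'v) set" where
  "E \<equiv> cylinder adj v0"

lemma lev_ray:
  assumes "\<omega> \<in> Omega"
  shows "lev (\<omega> i) = i"
proof -
  have "\<omega> 0 = v0" "gdist adj (\<omega> 0) (\<omega> i) = i"
    using assms by (auto simp: boundary_def)
  then show ?thesis by simp
qed

lemma parent_ray:
  assumes "\<omega> \<in> Omega"
  shows "parent (\<omega> (Suc i)) = \<omega> i"
proof -
  have "gdist adj (\<omega> i) (\<omega> (Suc i)) = 1"
    using assms by (auto simp: boundary_def)
  then show ?thesis
    by (intro parent_eqI gdist_1_adj) (auto simp: lev_ray[OF assms])
qed

lemma ancestor_ray:
  assumes "\<omega> \<in> Omega"
  shows "ancestor k (\<omega> (i + k)) = \<omega> i"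
  by (induction k arbitrary: i) (auto simp: parent_ray[OF assms] simp flip: add_Suc)

lemma mem_cylinder: "\<omega> \<in> E x \<longleftrightarrow> \<omega> \<in> Omega \<and> \<omega> (lev x) = x"
  by (auto simp: cylinder_def)

lemma mem_cylinder_ancestor:
  assumes "\<omega> \<in> Omega" "i \<le> lev x"
  shows "\<omega> \<in> E (ancestor (lev x - i) x) \<longleftrightarrow> \<omega> i = ancestor (lev x - i) x"
  using assms by (auto simp: mem_cylinder lev_ancestor)

text \<open>The vertices of the geodesic from \<open>v0\<close> to \<open>x\<close> that lie on a ray form an initial segment, and
  its length gives the height. All later estimates see the Poisson kernel through this lemma.\<close>

lemma height_cases:
  assumes \<omega>: "\<omega> \<in> Omega"
  shows "\<exists>j\<le>lev x. height adj v0 \<omega> x = 2 * int j - int (lev x) \<and>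
           (\<forall>i\<le>lev x. \<omega> \<in> E (ancestor (lev x - i) x) \<longleftrightarrow> i \<le> j)"
proof -
  define n where "n = lev x"
  define y where "y = (\<lambda>i. ancestor (n - i) x)"
  have lev_y: "lev (y i) = i" if "i \<le> n" for i
    using that by (simp add: y_def n_def lev_ancestor)
  define j where "j = Max {i. i \<le> n \<and> \<omega> i = y i}"
  have "\<omega> 0 = y 0"
    using \<omega> by (simp add: y_def n_def ancestor_lev boundary_def)
  then have ne: "{i. i \<le> n \<and> \<omega> i = y i} \<noteq> {}" and fin: "finite {i. i \<le> n \<and> \<omega> i = y i}"
    by auto
  have "j \<in> {i. i \<le> n \<and> \<omega> i = y i}"
    unfolding j_def by (rule Max_in[OF fin ne])
  then have j: "j \<le> n" "\<omega> j = y j"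
    by auto
  have above: "i \<le> j" if "i \<le> n" "\<omega> i = y i" for i
    unfolding j_def using that fin by (intro Max_ge) auto
  have below: "\<omega> i = y i" if "i \<le> j" for i
  proof -
    have "\<omega> i = ancestor (j - i) (y j)"
      using ancestor_ray[OF \<omega>, of "j - i" i] that j by simp
    also have "\<dots> = y i"
      using that j by (simp add: y_def flip: funpow_add[unfolded o_def, THEN fun_cong])
    finally show ?thesis .
  qed
  have on_ray: "y i \<in> range \<omega> \<longleftrightarrow> i \<le> j" if "i \<le> n" for i
  proof
    assume "y i \<in> range \<omega>"
    then obtain m where "y i = \<omega> m" by auto
    moreover have "m = i"
      using lev_y[OF that] lev_ray[OF \<omega>, of m] calculation by simp
    ultimately show "i \<le> j"
      using above that by simp
  qed (use below in \<open>metis rangeI\<close>)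
  have split: "[0..<Suc n] = [0..<Suc j] @ [Suc j..<Suc n]"
    using j upt_add_eq_append[of 0 "Suc j" "n - j"] by simp
  have "filter (\<lambda>i. y i \<in> range \<omega>) [0..<Suc n] = [0..<Suc j]"
  proof -
    have "filter (\<lambda>i. y i \<in> range \<omega>) [0..<Suc n] = filter (\<lambda>i. i \<le> j) [0..<Suc n]"
    proof (rule filter_cong[OF refl])
      fix i assume "i \<in> set [0..<Suc n]"
      then have "i \<le> n"
        by (simp only: set_upt atLeastLessThan_iff less_Suc_eq_le)
      then show "y i \<in> range \<omega> \<longleftrightarrow> i \<le> j"
        by (rule on_ray)
    qed
    also have "\<dots> = [0..<Suc j]"
    proof -
      have "filter (\<lambda>i. i \<le> j) [0..<Suc j] = [0..<Suc j]"
        by (intro filter_True) (simp del: upt_Suc add: less_Suc_eq_le)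
      moreover have "filter (\<lambda>i. i \<le> j) [Suc j..<Suc n] = []"
        by (intro filter_False) (simp del: upt_Suc)
      ultimately show ?thesis
        by (simp only: split filter_append append_Nil2)
    qed
    finally show ?thesis .
  qed
  then have "confluence adj v0 x \<omega> = y j"
    unfolding confluence_def geodesic_root n_def[symmetric] y_def[symmetric]
    by (simp add: filter_map o_def del: upt_Suc) (simp add: last_map)
  then have "height adj v0 \<omega> x = 2 * int j - int n"
    using lev_y[OF j(1)] by (simp add: height_def n_def)
  moreover have "\<omega> \<in> E (y i) \<longleftrightarrow> i \<le> j" if "i \<le> n" for i
  proof -
    have "\<omega> \<in> E (y i) \<longleftrightarrow> \<omega> i = y i"
      using mem_cylinder_ancestor[OF \<omega>, of i x] that by (simp add: y_def n_def)
    also have "\<dots> \<longleftrightarrow> i \<le> j"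
      using above[OF that] below by blast
    finally show ?thesis .
  qed
  ultimately show ?thesis
    using j(1) unfolding n_def y_def by blast
qed

subsection \<open>Counting descendants\<close>

definition descendants :: "nat \<Rightarrow> 'v \<Rightarrow> 'v set" where
  "descendants k y = {x. lev x = lev y + k \<and> ancestor k x = y}"

lemma descendants_0: "descendants 0 y = {y}"
  by (auto simp: descendants_def)

lemma descendants_Suc: "descendants (Suc k) y \<subseteq> (\<Union>x\<in>descendants k y. descendants 1 x)"
proof
  fix x assume "x \<in> descendants (Suc k) y"
  then have x: "lev x = Suc (lev y + k)" "ancestor k (parent x) = y"
    by (auto simp: descendants_def funpow_swap1)
  then have "parent x \<in> descendants k y" "x \<in> descendants 1 (parent x)"
    using parent[OF x(1)] by (auto simp: descendants_def)
  then show "x \<in> (\<Union>x\<in>descendants k y. descendants 1 x)"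
    by blast
qed

lemma descendants_1_subset: "descendants 1 x \<subseteq> {y. adj x y}"
proof
  fix y assume "y \<in> descendants 1 x"
  then have "lev y = Suc (lev x)" "parent y = x"
    by (auto simp: descendants_def)
  then show "y \<in> {y. adj x y}"
    using parent(1)[of y] by simp
qed

lemma finite_descendants_1: "finite (descendants 1 x)"
  using finite_subset[OF descendants_1_subset finite_neighbours] .

lemma card_descendants_1_le: "card (descendants 1 x) \<le> q + 1"
  using card_mono[OF finite_neighbours descendants_1_subset] degree by simp

lemma card_descendants_1_le_nonroot:
  assumes "lev x \<noteq> 0"
  shows "card (descendants 1 x) \<le> q"
proof -
  obtain n where n: "lev x = Suc n"
    using assms by (cases "lev x") auto
  have "descendants 1 x \<subseteq> {y. adj x y} - {parent x}"
  proof
    fix y assume y: "y \<in> descendants 1 x"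
    then have "lev y = Suc (Suc n)"
      using n by (simp add: descendants_def)
    then have "y \<noteq> parent x"
      using parent(2)[OF n] by (metis Suc_n_not_le_n le_Suc_eq order.refl)
    then show "y \<in> {y. adj x y} - {parent x}"
      using y descendants_1_subset by blast
  qed
  then have "card (descendants 1 x) \<le> card ({y. adj x y} - {parent x})"
    using finite_neighbours by (intro card_mono) auto
  also have "\<dots> = q"
    using parent[OF n] degree[of x] finite_neighbours by (simp add: adj_sym)
  finally show ?thesis .
qed

lemma finite_descendants: "finite (descendants k y)"
proof (induction k)
  case (Suc k)
  then show ?case
    using finite_descendants_1 by (intro finite_subset[OF descendants_Suc]) auto
qed (simp add: descendants_0)

text \<open>The root has one child more than the other vertices; the factor 2 absorbs this.\<close>

lemma card_descendants_le: "card (descendants k y) \<le> 2 * q ^ k"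
proof (cases k)
  case 0
  then show ?thesis by (simp add: descendants_0)
next
  case (Suc k')
  have "card (descendants (Suc k') y) \<le> 2 * q ^ Suc k'"
  proof (induction k')
    case 0
    show ?case
      using card_descendants_1_le[of y] q_ge_2 by simp
  next
    case (Suc k')
    have "card (descendants (Suc (Suc k')) y) \<le> card (\<Union>x\<in>descendants (Suc k') y. descendants 1 x)"
      using finite_descendants by (intro card_mono descendants_Suc) auto
    also have "\<dots> \<le> (\<Sum>x\<in>descendants (Suc k') y. card (descendants 1 x))"
      using finite_descendants by (intro card_UN_le)
    also have "\<dots> \<le> (\<Sum>x\<in>descendants (Suc k') y. q)"
      by (intro sum_mono card_descendants_1_le_nonroot) (auto simp: descendants_def)
    also have "\<dots> \<le> 2 * q ^ Suc (Suc k')"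
      using Suc by simp
    finally show ?case .
  qed
  then show ?thesis by (simp add: Suc)
qed

lemma finite_ball: "finite {x. lev x \<le> n}"
proof (rule finite_subset)
  show "{x. lev x \<le> n} \<subseteq> (\<Union>k\<le>n. descendants k v0)"
    by (auto simp: descendants_def lev_root ancestor_lev)
qed (auto intro: finite_descendants)

lemma countable_vertices: "countable (UNIV :: 'v set)"
proof -
  have "(UNIV :: 'v set) = (\<Union>n. {x. lev x \<le> n})"
    by auto
  also have "countable \<dots>"
    by (intro countable_UN) (auto intro: countable_finite finite_ball)
  finally show ?thesis .
qed

subsection \<open>The boundary measure\<close>

abbreviation \<nu> :: "(nat \<Rightarrow> 'v) measure" where
  "\<nu> \<equiv> boundary_measure q adj v0"

lemma cylinder_subset: "E x \<subseteq> Omega"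
  by (auto simp: cylinder_def)

lemma space_nu: "space \<nu> = Omega"
  unfolding boundary_measure_def using cylinder_subset by (intro space_extend_measure) auto

lemma cylinder_sets [measurable]: "E x \<in> sets \<nu>"
  unfolding boundary_measure_def using cylinder_subset
  by (subst sets_extend_measure) (auto intro: sigma_sets.Basic)

text \<open>The real powers of the Poisson kernel will be dominated by combinations of indicators of
  cylinders with nonnegative coefficients, so the integrals are controlled by upper bounds for the
  measures of cylinders. The prescribed values are such bounds in either branch of the definition of
  the extended measure.\<close>

lemma emeasure_extend_measure_le:
  assumes "G ` I \<subseteq> Pow S" "i \<in> I"
  shows "emeasure (extend_measure S I G \<mu>) (G i) \<le> \<mu> i"
proof -
  let ?P = "\<lambda>\<mu>'. (\<forall>i\<in>I. \<mu>' (G i) = \<mu> i) \<and> measure_space S (sigma_sets S (G ` I)) \<mu>'"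
  show ?thesis
  proof (cases "(\<exists>\<mu>'. ?P \<mu>') \<and> \<not> (\<forall>i\<in>I. \<mu> i = 0)")
    case True
    then obtain \<mu>' where "?P \<mu>'" by blast
    have "emeasure (extend_measure S I G \<mu>) (G i) = \<mu> i"
      using \<open>?P \<mu>'\<close> assms
      by (intro emeasure_extend_measure[OF refl, where \<mu>' = \<mu>'])
        (auto simp: sets_extend_measure measure_space_def)
    then show ?thesis by simp
  next
    case False
    then have "extend_measure S I G \<mu> = measure_of S (G ` I) (\<lambda>_. 0)"
      unfolding extend_measure_def by (intro if_not_P)
    then have "emeasure (extend_measure S I G \<mu>) (G i) = 0"
      using emeasure_sigma[of S "G ` I"] by simp
    then show ?thesis by simp
  qed
qed

lemma emeasure_cylinder_le:
  "emeasure \<nu> (E x) \<le> (if x = v0 then 1 else ennreal (real q / (real (q + 1) * real q ^ lev x)))"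
  unfolding boundary_measure_def using cylinder_subset by (intro emeasure_extend_measure_le) auto

lemma emeasure_cylinder_le_power: "emeasure \<nu> (E x) \<le> ennreal (1 / real q ^ lev x)"
proof (cases "x = v0")
  case False
  have "real q / (real (q + 1) * real q ^ lev x) \<le> 1 / real q ^ lev x"
    using q_ge_2 by (simp add: frac_le divide_simps del: of_nat_add)
  then show ?thesis
    using emeasure_cylinder_le[of x] False by (simp add: order_trans ennreal_leI)
qed (use emeasure_cylinder_le[of x] in \<open>simp add: lev_root\<close>)

end

section \<open>Norms with exponent in the extended half-line\<close>

lemma exponent_cases:
  assumes "1 \<le> (r::ennreal)"
  obtains (top) "r = \<infinity>" | (real) \<rho> where "r = ennreal \<rho>" "1 \<le> \<rho>"
  using assms by (cases r) auto

lemma Lp_norm_real_le_iff: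
  assumes "0 < \<rho>" "0 \<le> c"
  shows "Lp_norm M (ennreal \<rho>) f \<le> ennreal c \<longleftrightarrow>
    (\<integral>\<^sup>+x. ennreal (norm (f x) powr \<rho>) \<partial>M) \<le> ennreal (c powr \<rho>)"
proof (cases "\<integral>\<^sup>+x. ennreal (norm (f x) powr \<rho>) \<partial>M")
  case (real I)
  have "I powr (1 / \<rho>) \<le> c \<longleftrightarrow> I \<le> c powr \<rho>"
  proof
    assume "I powr (1 / \<rho>) \<le> c"
    then have "(I powr (1 / \<rho>)) powr \<rho> \<le> c powr \<rho>"
      using assms by (intro powr_mono2) auto
    then show "I \<le> c powr \<rho>"
      using assms real by (simp add: powr_powr)
  next
    assume "I \<le> c powr \<rho>"
    then have "I powr (1 / \<rho>) \<le> (c powr \<rho>) powr (1 / \<rho>)"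
      using assms real by (intro powr_mono2) auto
    then show "I powr (1 / \<rho>) \<le> c"
      using assms by (simp add: powr_powr)
  qed
  then show ?thesis
    using assms real by (simp add: Lp_norm_def Let_def)
next
  case top
  then show ?thesis
    using assms by (simp add: Lp_norm_def Let_def top_unique)
qed

lemma Lp_norm_infinity_le_iff:
  assumes [measurable]: "f \<in> borel_measurable M"
  shows "Lp_norm M \<infinity> f \<le> c \<longleftrightarrow> (AE x in M. ennreal (norm (f x)) \<le> c)"
proof
  assume "Lp_norm M \<infinity> f \<le> c"
  moreover have "AE x in M. ennreal (norm (f x)) \<le> esssup M (\<lambda>x. ennreal (norm (f x)))"
    by (rule esssup_AE)
  ultimately show "AE x in M. ennreal (norm (f x)) \<le> c"
    by (auto simp: Lp_norm_def elim: eventually_mono)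
qed (auto simp: Lp_norm_def)

lemma Lp_norm_leI:
  assumes "0 < \<rho>" "0 \<le> c" "(\<integral>\<^sup>+x. ennreal (norm (f x) powr \<rho>) \<partial>M) \<le> ennreal (c powr \<rho>)"
  shows "Lp_norm M (ennreal \<rho>) f \<le> ennreal c"
  using Lp_norm_real_le_iff[OF assms(1,2)] assms(3) by blast

lemma Lp_norm_AE_mono:
  assumes r: "1 \<le> r" and f [measurable]: "f \<in> borel_measurable M" "g \<in> borel_measurable M"
    and le: "AE x in M. norm (f x) \<le> norm (g x)"
  shows "Lp_norm M r f \<le> Lp_norm M r g"
  using r
proof (cases rule: exponent_cases)
  case top
  have "esssup M (\<lambda>x. ennreal (norm (f x))) \<le> esssup M (\<lambda>x. ennreal (norm (g x)))"
    using le by (intro esssup_AE_mono) (auto intro: ennreal_leI elim: eventually_mono)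
  with top show ?thesis
    by (simp add: Lp_norm_def)
next
  case (real \<rho>)
  show ?thesis
  proof (cases "Lp_norm M r g")
    case (real c)
    have "(\<integral>\<^sup>+x. ennreal (norm (f x) powr \<rho>) \<partial>M) \<le> (\<integral>\<^sup>+x. ennreal (norm (g x) powr \<rho>) \<partial>M)"
      using le \<open>1 \<le> \<rho>\<close>
      by (intro nn_integral_mono_AE) (auto intro!: ennreal_leI powr_mono2 elim!: eventually_mono)
    also have "\<dots> \<le> ennreal (c powr \<rho>)"
      using Lp_norm_real_le_iff[of \<rho> c M g] real \<open>1 \<le> \<rho>\<close> \<open>r = ennreal \<rho>\<close> by simp
    finally show ?thesis
      using Lp_norm_leI[of \<rho> c M f] real \<open>1 \<le> \<rho>\<close> \<open>r = ennreal \<rho>\<close> by simp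
  qed simp
qed

lemma Lp_norm_zero:
  assumes "1 \<le> r"
  shows "Lp_norm M r (\<lambda>x. 0) = 0"
  using assms
proof (cases rule: exponent_cases)
  case top
  have "Lp_norm M r (\<lambda>x. 0) \<le> 0"
    unfolding top by (subst Lp_norm_infinity_le_iff) auto
  then show ?thesis by simp
next
  case (real \<rho>)
  have "Lp_norm M r (\<lambda>x. 0) \<le> ennreal 0"
    unfolding real using real by (intro Lp_norm_leI) auto
  then show ?thesis by simp
qed

lemma Lp_norm_cmult_le:
  assumes r: "1 \<le> r" and [measurable]: "f \<in> borel_measurable M"
  shows "Lp_norm M r (\<lambda>x. c * f x) \<le> ennreal (norm c) * Lp_norm M r f"
proof (cases "c = 0")
  case True
  then show ?thesis using Lp_norm_zero[OF r] by simp
next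
  case False
  show ?thesis
  proof (cases "Lp_norm M r f")
    case a: (real a)
    from r show ?thesis
    proof (cases rule: exponent_cases)
      case top
      have "AE x in M. ennreal (norm (f x)) \<le> ennreal a"
        using Lp_norm_infinity_le_iff[of f M "ennreal a"] a top by simp
      then have "AE x in M. ennreal (norm (c * f x)) \<le> ennreal (norm c) * ennreal a"
        by (elim eventually_mono) (simp add: norm_mult ennreal_mult mult_left_mono)
      then have "Lp_norm M \<infinity> (\<lambda>x. c * f x) \<le> ennreal (norm c) * ennreal a"
        by (subst Lp_norm_infinity_le_iff) auto
      then show ?thesis
        using a top by simp
    next
      case (real \<rho>)
      have "(\<integral>\<^sup>+x. ennreal (norm (c * f x) powr \<rho>) \<partial>M) =
          ennreal (norm c powr \<rho>) * (\<integral>\<^sup>+x. ennreal (norm (f x) powr \<rho>) \<partial>M)"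
        by (subst nn_integral_cmult[symmetric])
          (auto simp: norm_mult powr_mult simp flip: ennreal_mult)
      also have "\<dots> \<le> ennreal (norm c powr \<rho>) * ennreal (a powr \<rho>)"
        using Lp_norm_real_le_iff[of \<rho> a M f] a real by (intro mult_left_mono) auto
      also have "\<dots> = ennreal ((norm c * a) powr \<rho>)"
        using a by (simp add: powr_mult flip: ennreal_mult)
      finally have "Lp_norm M r (\<lambda>x. c * f x) \<le> ennreal (norm c * a)"
        unfolding \<open>r = _\<close> using real a by (intro Lp_norm_leI) auto
      then show ?thesis
        using a by (simp add: ennreal_mult)
    qed
  qed (use False in \<open>simp add: ennreal_mult_top\<close>)
qed

lemma powr_mean_le:
  fixes x y t \<rho> :: real
  assumes "1 \<le> \<rho>" "0 \<le> t" "t \<le> 1" "0 \<le> x" "0 \<le> y"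
  shows "((1 - t) * x + t * y) powr \<rho> \<le> (1 - t) * x powr \<rho> + t * y powr \<rho>"
proof -
  have shrink: "(s * u) powr \<rho> \<le> s * u powr \<rho>" if "0 \<le> s" "s \<le> 1" "0 \<le> u" for s u :: real
  proof -
    have "s powr \<rho> \<le> s powr 1"
      using that assms by (intro powr_mono') auto
    then show ?thesis
      using that by (simp add: powr_mult mult_right_mono)
  qed
  consider "x = 0" | "y = 0" | "x > 0" "y > 0"
    using assms by linarith
  then show ?thesis
  proof cases
    case 3
    then show ?thesis
      using convex_onD[OF powr_convex[OF assms(1)], of t x y] assms by simp
  qed (use shrink[of t y] shrink[of "1 - t" x] assms in auto)
qed

text \<open>Minkowski's inequality is the convexity of \<open>x\<^sup>\<rho>\<close>, applied to the convex combination of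
  \<open>f / a\<close> and \<open>g / b\<close> with weights \<open>a / (a + b)\<close> and \<open>b / (a + b)\<close>, where \<open>a\<close> and \<open>b\<close> are (slightly
  larger than) the two norms.\<close>

lemma Lp_norm_triangle:
  assumes r: "1 \<le> r" and [measurable]: "f \<in> borel_measurable M" "g \<in> borel_measurable M"
  shows "Lp_norm M r (\<lambda>x. f x + g x) \<le> Lp_norm M r f + Lp_norm M r g"
proof (rule ennreal_le_epsilon)
  fix e :: real
  assume fin: "Lp_norm M r f + Lp_norm M r g < top" and e: "0 < e"
  obtain a' b' where ab': "Lp_norm M r f = ennreal a'" "Lp_norm M r g = ennreal b'" "0 \<le> a'" "0 \<le> b'"
    using fin by (cases "Lp_norm M r f"; cases "Lp_norm M r g") auto
  define a where "a = a' + e / 2"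
  define b where "b = b' + e / 2"
  have ab: "0 < a" "0 < b" "Lp_norm M r f \<le> ennreal a" "Lp_norm M r g \<le> ennreal b"
    using ab' e by (auto simp: a_def b_def intro: ennreal_leI)
  have sum: "Lp_norm M r f + Lp_norm M r g + ennreal e = ennreal (a + b)"
    using ab' e by (simp add: a_def b_def flip: ennreal_plus)
  from r show "Lp_norm M r (\<lambda>x. f x + g x) \<le> Lp_norm M r f + Lp_norm M r g + ennreal e"
  proof (cases rule: exponent_cases)
    case top
    have "AE x in M. ennreal (norm (f x)) \<le> ennreal a" "AE x in M. ennreal (norm (g x)) \<le> ennreal b"
      using ab top Lp_norm_infinity_le_iff[of f M] Lp_norm_infinity_le_iff[of g M] by auto
    then have "AE x in M. ennreal (norm (f x + g x)) \<le> ennreal (a + b)"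
    proof eventually_elim
      case (elim x)
      then have "norm (f x) \<le> a" "norm (g x) \<le> b"
        using ab by auto
      then show ?case
        by (intro ennreal_leI) (use norm_triangle_ineq[of "f x" "g x"] in linarith)
    qed
    then have "Lp_norm M \<infinity> (\<lambda>x. f x + g x) \<le> ennreal (a + b)"
      by (subst Lp_norm_infinity_le_iff) auto
    then show ?thesis
      unfolding sum using top by simp
  next
    case (real \<rho>)
    define t where "t = b / (a + b)"
    have t: "0 \<le> t" "t \<le> 1" "(a + b) * (1 - t) = a" "(a + b) * t = b"
      using ab by (auto simp: t_def field_simps)
    define K where "K = (a + b) powr \<rho>"
    have int: "(\<integral>\<^sup>+x. ennreal (norm (f x) powr \<rho>) \<partial>M) \<le> ennreal (a powr \<rho>)"
      "(\<integral>\<^sup>+x. ennreal (norm (g x) powr \<rho>) \<partial>M) \<le> ennreal (b powr \<rho>)"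
      using ab real Lp_norm_real_le_iff[of \<rho> a M f] Lp_norm_real_le_iff[of \<rho> b M g] by auto
    have pointwise: "norm (f x + g x) powr \<rho> \<le>
        K * (1 - t) / a powr \<rho> * norm (f x) powr \<rho> + K * t / b powr \<rho> * norm (g x) powr \<rho>" for x
    proof -
      have "norm (f x + g x) \<le> (a + b) * ((1 - t) * (norm (f x) / a) + t * (norm (g x) / b))"
        using norm_triangle_ineq[of "f x" "g x"] t ab by (simp add: distrib_left flip: mult.assoc)
      then have "norm (f x + g x) powr \<rho> \<le>
          ((a + b) * ((1 - t) * (norm (f x) / a) + t * (norm (g x) / b))) powr \<rho>"
        using real by (intro powr_mono2) auto
      also have "\<dots> = K * ((1 - t) * (norm (f x) / a) + t * (norm (g x) / b)) powr \<rho>"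
        unfolding K_def by (rule powr_mult)
      also have "\<dots> \<le> K * ((1 - t) * (norm (f x) / a) powr \<rho> + t * (norm (g x) / b) powr \<rho>)"
        using t ab real by (intro mult_left_mono powr_mean_le) (auto simp: K_def)
      also have "\<dots> = K * (1 - t) / a powr \<rho> * norm (f x) powr \<rho> + K * t / b powr \<rho> * norm (g x) powr \<rho>"
        using ab by (simp add: powr_divide algebra_simps)
      finally show ?thesis .
    qed
    have coeff: "0 \<le> K * (1 - t) / a powr \<rho>" "0 \<le> K * t / b powr \<rho>"
      using t by (auto simp: K_def)
    have "(\<integral>\<^sup>+x. ennreal (norm (f x + g x) powr \<rho>) \<partial>M) \<le>
        (\<integral>\<^sup>+x. ennreal (K * (1 - t) / a powr \<rho>) * ennreal (norm (f x) powr \<rho>) +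
              ennreal (K * t / b powr \<rho>) * ennreal (norm (g x) powr \<rho>) \<partial>M)"
    proof (rule nn_integral_mono)
      fix x
      have "ennreal (norm (f x + g x) powr \<rho>) \<le> ennreal (K * (1 - t) / a powr \<rho> * norm (f x) powr \<rho>
          + K * t / b powr \<rho> * norm (g x) powr \<rho>)"
        by (intro ennreal_leI pointwise)
      also have "\<dots> = ennreal (K * (1 - t) / a powr \<rho>) * ennreal (norm (f x) powr \<rho>) +
          ennreal (K * t / b powr \<rho>) * ennreal (norm (g x) powr \<rho>)"
        using coeff by (subst ennreal_plus) (auto simp only: ennreal_mult powr_ge_zero mult_nonneg_nonneg)
      finally show "ennreal (norm (f x + g x) powr \<rho>) \<le>
          ennreal (K * (1 - t) / a powr \<rho>) * ennreal (norm (f x) powr \<rho>) +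
          ennreal (K * t / b powr \<rho>) * ennreal (norm (g x) powr \<rho>)" .
    qed
    also have "\<dots> = ennreal (K * (1 - t) / a powr \<rho>) * (\<integral>\<^sup>+x. ennreal (norm (f x) powr \<rho>) \<partial>M) +
        ennreal (K * t / b powr \<rho>) * (\<integral>\<^sup>+x. ennreal (norm (g x) powr \<rho>) \<partial>M)"
      by (simp add: nn_integral_add nn_integral_cmult)
    also have "\<dots> \<le> ennreal (K * (1 - t) / a powr \<rho>) * ennreal (a powr \<rho>) +
        ennreal (K * t / b powr \<rho>) * ennreal (b powr \<rho>)"
      by (intro add_mono mult_left_mono int) auto
    also have "\<dots> = ennreal (K * (1 - t) / a powr \<rho> * a powr \<rho> + K * t / b powr \<rho> * b powr \<rho>)"
      using coeff by (auto simp only: ennreal_mult ennreal_plus powr_ge_zero mult_nonneg_nonneg)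
    also have "K * (1 - t) / a powr \<rho> * a powr \<rho> + K * t / b powr \<rho> * b powr \<rho> = K * (1 - t) + K * t"
      using ab by simp
    also have "\<dots> = (a + b) powr \<rho>"
      by (simp add: K_def algebra_simps)
    finally show ?thesis
      unfolding sum unfolding \<open>r = _\<close> using ab real by (intro Lp_norm_leI) auto
  qed
qed

lemma Lp_norm_sum_le:
  assumes "1 \<le> r" "finite I" "\<And>i. i \<in> I \<Longrightarrow> f i \<in> borel_measurable M"
  shows "Lp_norm M r (\<lambda>x. \<Sum>i\<in>I. f i x) \<le> (\<Sum>i\<in>I. Lp_norm M r (f i))"
  using assms(2,3)
proof (induction I rule: finite_induct)
  case empty
  then show ?case
    using Lp_norm_zero[OF assms(1)] by simp
next
  case (insert i I)
  have "Lp_norm M r (\<lambda>x. f i x + (\<Sum>i\<in>I. f i x)) \<le> Lp_norm M r (f i) + Lp_norm M r (\<lambda>x. \<Sum>i\<in>I. f i x)"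
    using insert by (intro Lp_norm_triangle assms(1) borel_measurable_sum) auto
  also have "\<dots> \<le> Lp_norm M r (f i) + (\<Sum>i\<in>I. Lp_norm M r (f i))"
    using insert by (intro add_left_mono) auto
  finally show ?case
    using insert by simp
qed

text \<open>The monotone convergence theorem for norms: it carries bounds from finite partial sums over to
  infinite sums.\<close>

lemma Lp_norm_monotone_limit:
  fixes u :: "nat \<Rightarrow> 'a \<Rightarrow> real"
  assumes r: "1 \<le> r" and [measurable]: "\<And>n. u n \<in> borel_measurable M"
    and nonneg: "\<And>n x. 0 \<le> u n x" and inc: "\<And>m n x. m \<le> n \<Longrightarrow> u m x \<le> u n x"
    and c: "0 \<le> c" and bound: "\<And>n. Lp_norm M r (\<lambda>x. of_real (u n x)) \<le> ennreal c"
  shows "AE x in M. (SUP n. ennreal (u n x)) < \<infinity>"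
    and "v \<in> borel_measurable M \<Longrightarrow> AE x in M. ennreal (norm (v x)) \<le> (SUP n. ennreal (u n x)) \<Longrightarrow>
      Lp_norm M r v \<le> ennreal c"
proof -
  have "(AE x in M. (SUP n. ennreal (u n x)) < \<infinity>) \<and>
    (v \<in> borel_measurable M \<longrightarrow> (AE x in M. ennreal (norm (v x)) \<le> (SUP n. ennreal (u n x))) \<longrightarrow>
      Lp_norm M r v \<le> ennreal c)" for v
    using r
  proof (cases rule: exponent_cases)
    case top
    have "AE x in M. ennreal (u n x) \<le> ennreal c" for n
      using bound[of n] nonneg unfolding top by (subst (asm) Lp_norm_infinity_le_iff) auto
    then have "AE x in M. \<forall>n. ennreal (u n x) \<le> ennreal c"
      by (simp add: AE_all_countable)
    then have *: "AE x in M. (SUP n. ennreal (u n x)) \<le> ennreal c"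
      by (elim eventually_mono) (auto intro: SUP_least)
    then have "AE x in M. (SUP n. ennreal (u n x)) < \<infinity>"
      by (elim eventually_mono) (auto intro: le_less_trans)
    moreover have "Lp_norm M r v \<le> ennreal c" if "v \<in> borel_measurable M"
      "AE x in M. ennreal (norm (v x)) \<le> (SUP n. ennreal (u n x))"
    proof -
      have "AE x in M. ennreal (norm (v x)) \<le> ennreal c"
        using * that(2) by eventually_elim (rule order_trans)
      then show ?thesis
        unfolding top by (subst Lp_norm_infinity_le_iff) (use that in auto)
    qed
    ultimately show ?thesis by blast
  next
    case (real \<rho>)
    define s where "s = (\<lambda>x. SUP n. ennreal (u n x powr \<rho>))"
    have [measurable]: "s \<in> borel_measurable M"
      unfolding s_def by measurable
    have "(\<integral>\<^sup>+x. s x \<partial>M) = (SUP n. \<integral>\<^sup>+x. ennreal (u n x powr \<rho>) \<partial>M)"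
      unfolding s_def using inc nonneg real
      by (intro nn_integral_monotone_convergence_SUP incseq_SucI le_funI ennreal_leI powr_mono2) auto
    also have "\<dots> \<le> ennreal (c powr \<rho>)"
      using bound nonneg real c Lp_norm_real_le_iff[of \<rho> c M "\<lambda>x. of_real (u _ x)"]
      by (intro SUP_least) auto
    finally have int: "(\<integral>\<^sup>+x. s x \<partial>M) \<le> ennreal (c powr \<rho>)" .
    have root: "(SUP n. ennreal (u n x)) \<le> ennreal (B powr (1 / \<rho>))"
      if "s x = ennreal B" "0 \<le> B" for x B
    proof (intro SUP_least ennreal_leI)
      fix n
      have "ennreal (u n x powr \<rho>) \<le> ennreal B"
        unfolding that(1)[symmetric] s_def by (intro SUP_upper) auto
      then have "(u n x powr \<rho>) powr (1 / \<rho>) \<le> B powr (1 / \<rho>)"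
        using that real by (intro powr_mono2) auto
      then show "u n x \<le> B powr (1 / \<rho>)"
        using nonneg real by (simp add: powr_powr)
    qed
    have "AE x in M. s x \<noteq> \<infinity>"
      using int by (intro nn_integral_PInf_AE) (auto simp: top_unique)
    then have "AE x in M. (SUP n. ennreal (u n x)) < \<infinity>"
    proof eventually_elim
      case (elim x)
      then obtain B where "s x = ennreal B" "0 \<le> B"
        by (cases "s x") auto
      from root[OF this] show ?case
        by (auto intro: le_less_trans)
    qed
    moreover have "Lp_norm M r v \<le> ennreal c" if "v \<in> borel_measurable M"
      "AE x in M. ennreal (norm (v x)) \<le> (SUP n. ennreal (u n x))"
    proof -
      have "AE x in M. ennreal (norm (v x) powr \<rho>) \<le> s x"
        using that(2)
      proof eventually_elim
        case (elim x)
        show ?case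
        proof (cases "s x")
          case B: (real B)
          have "ennreal (norm (v x)) \<le> ennreal (B powr (1 / \<rho>))"
            using order_trans[OF elim root[of x B]] B by blast
          then have "norm (v x) powr \<rho> \<le> (B powr (1 / \<rho>)) powr \<rho>"
            using real by (intro powr_mono2) auto
          then show ?thesis
            using B real by (simp add: powr_powr ennreal_leI)
        qed simp
      qed
      then have "(\<integral>\<^sup>+x. ennreal (norm (v x) powr \<rho>) \<partial>M) \<le> (\<integral>\<^sup>+x. s x \<partial>M)"
        by (rule nn_integral_mono_AE)
      also note int
      finally show ?thesis
        unfolding \<open>r = _\<close> using c real by (intro Lp_norm_leI) auto
    qed
    ultimately show ?thesis by blast
  qed
  then show "AE x in M. (SUP n. ennreal (u n x)) < \<infinity>"
    and "v \<in> borel_measurable M \<Longrightarrow> AE x in M. ennreal (norm (v x)) \<le> (SUP n. ennreal (u n x)) \<Longrightarrow>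
      Lp_norm M r v \<le> ennreal c"
    by blast+
qed

section \<open>Sums of powers\<close>

text \<open>Integer exponents cover dyadic levels and decreasing geometric sums alike: in every case the
  largest term dominates.\<close>

lemma sum_powr_int_le:
  fixes b \<tau> :: real and J :: "int set"
  assumes b: "1 < b" and "finite J" "0 \<le> \<tau>" "\<And>j. j \<in> J \<Longrightarrow> b powr j \<le> \<tau>"
  shows "(\<Sum>j\<in>J. b powr j) \<le> b / (b - 1) * \<tau>"
proof -
  have max: "(\<Sum>j\<in>J. b powr j) \<le> b / (b - 1) * b powr u" if "finite J" "\<And>j. j \<in> J \<Longrightarrow> j \<le> u" for u :: int and J :: "int set"
    using that
  proof (induction J arbitrary: u rule: finite_linorder_max_induct)
    case empty
    then show ?case using b by simp
  next
    case (insert m J)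
    have "(\<Sum>j\<in>insert m J. b powr j) = b powr m + (\<Sum>j\<in>J. b powr j)"
      using insert by (subst sum.insert) auto
    also have "\<dots> \<le> b powr m + b / (b - 1) * b powr (m - 1)"
      using insert.hyps by (intro add_left_mono insert.IH) force
    also have "\<dots> = b / (b - 1) * b powr m"
      using b by (simp add: powr_diff field_simps)
    also have "\<dots> \<le> b / (b - 1) * b powr u"
      using insert.prems b by (intro mult_left_mono powr_mono) auto
    finally show ?case .
  qed
  show ?thesis
  proof (cases "J = {}")
    case True
    then show ?thesis using assms by simp
  next
    case False
    have "(\<Sum>j\<in>J. b powr j) \<le> b / (b - 1) * b powr (Max J)"
      using assms by (intro max) auto
    also have "\<dots> \<le> b / (b - 1) * \<tau>"
      using assms False by (intro mult_left_mono assms(4)) auto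
    finally show ?thesis .
  qed
qed

lemma powr_diff_le:
  fixes x y \<rho> :: real
  assumes "1 \<le> \<rho>" "0 \<le> y" "y \<le> x"
  shows "x powr \<rho> - y powr \<rho> \<le> \<rho> * (x - y) * x powr (\<rho> - 1)"
proof (cases "x = y")
  case False
  then have "y < x" using assms by simp
  have "continuous_on {y..x} (\<lambda>x. x powr \<rho>)"
    using assms by (intro continuous_on_powr' continuous_intros) auto
  moreover have "((\<lambda>x. x powr \<rho>) has_real_derivative \<rho> * z powr (\<rho> - 1)) (at z)" if "y < z" for z
    using that assms by (auto intro!: derivative_eq_intros)
  ultimately obtain z where z: "y < z" "z < x" "x powr \<rho> - y powr \<rho> = (x - y) * (\<rho> * z powr (\<rho> - 1))"
    using MVT[OF \<open>y < x\<close>, of "\<lambda>x. x powr \<rho>"] DERIV_unique real_differentiable_def by metis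
  have "z powr (\<rho> - 1) \<le> x powr (\<rho> - 1)"
    using z assms by (intro powr_mono2) auto
  then have "(x - y) * (\<rho> * z powr (\<rho> - 1)) \<le> (x - y) * (\<rho> * x powr (\<rho> - 1))"
    using z assms by (intro mult_left_mono) auto
  with z show ?thesis by (simp add: mult_ac)
qed simp

text \<open>A geometrically growing sum with coefficients in \<open>[0, A]\<close> behaves like its largest term:
  its \<open>\<rho>\<close>-th power is \<open>O(A\<^sup>\<rho>\<^sup>-\<^sup>1)\<close> times a sum that is linear in the coefficients. Indeed the partial sum up to \<open>j\<close> is \<open>O(A b\<^sup>j)\<close>, so adding the term
  \<open>b\<^sup>j a j\<close> increases the \<open>\<rho>\<close>-th power by \<open>O(b\<^sup>j a j (A b\<^sup>j)\<^sup>\<rho>\<^sup>-\<^sup>1)\<close>.\<close>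

lemma lacunary_sum_powr_le:
  fixes a :: "nat \<Rightarrow> real" and b A \<rho> :: real
  assumes b: "1 < b" and \<rho>: "1 \<le> \<rho>" and a: "\<And>j. 0 \<le> a j" "\<And>j. a j \<le> A"
  shows "(\<Sum>j<n. b ^ j * a j) powr \<rho> \<le>
    \<rho> * (b / (b - 1) * A) powr (\<rho> - 1) * (\<Sum>j<n. (b powr \<rho>) ^ j * a j)"
proof (induction n)
  case (Suc n)
  define S where "S = (\<lambda>n. \<Sum>j<n. b ^ j * a j)"
  define K where "K = (b / (b - 1) * A) powr (\<rho> - 1)"
  have A: "0 \<le> A" using a order_trans by blast
  have S_nonneg: "0 \<le> S n" for n
    unfolding S_def using a b by (intro sum_nonneg) auto
  have "S (Suc n) \<le> (\<Sum>j<Suc n. b ^ j * A)"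
    unfolding S_def using a b by (intro sum_mono mult_left_mono) auto
  also have "\<dots> = (b ^ Suc n - 1) / (b - 1) * A"
    using b by (subst sum_distrib_right[symmetric], subst geometric_sum) auto
  also have "\<dots> \<le> b ^ Suc n / (b - 1) * A"
    using b A by (intro mult_right_mono divide_right_mono) auto
  also have "\<dots> = b ^ n * (b / (b - 1) * A)"
    by simp
  finally have "S (Suc n) powr (\<rho> - 1) \<le> (b ^ n * (b / (b - 1) * A)) powr (\<rho> - 1)"
    using S_nonneg \<rho> by (intro powr_mono2) auto
  also have "\<dots> = (b ^ n) powr (\<rho> - 1) * K"
    unfolding K_def by (rule powr_mult)
  finally have *: "S (Suc n) powr (\<rho> - 1) \<le> (b ^ n) powr (\<rho> - 1) * K" .
  have "S (Suc n) powr \<rho> - S n powr \<rho> \<le> \<rho> * (S (Suc n) - S n) * S (Suc n) powr (\<rho> - 1)"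
    using S_nonneg \<rho> a b by (intro powr_diff_le) (auto simp: S_def)
  also have "\<dots> \<le> \<rho> * (S (Suc n) - S n) * ((b ^ n) powr (\<rho> - 1) * K)"
    using * \<rho> a b by (intro mult_left_mono) (auto simp: S_def)
  also have "\<dots> = \<rho> * K * ((b ^ n * (b ^ n) powr (\<rho> - 1)) * a n)"
    by (simp add: S_def)
  also have "b ^ n * (b ^ n) powr (\<rho> - 1) = (b powr \<rho>) ^ n"
  proof -
    have "b ^ n * (b ^ n) powr (\<rho> - 1) = b powr (n + n * (\<rho> - 1))"
      using b by (simp add: powr_add powr_powr flip: powr_realpow)
    also have "\<dots> = (b powr \<rho>) ^ n"
      using b by (simp add: powr_powr algebra_simps flip: powr_realpow)
    finally show ?thesis .
  qed
  finally have "S (Suc n) powr \<rho> \<le> S n powr \<rho> + \<rho> * K * ((b powr \<rho>) ^ n * a n)"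
    by simp
  also have "\<dots> \<le> \<rho> * K * (\<Sum>j<n. (b powr \<rho>) ^ j * a j) + \<rho> * K * ((b powr \<rho>) ^ n * a n)"
    using Suc by (simp add: S_def K_def)
  finally show ?case
    by (simp add: S_def K_def distrib_left)
qed simp

section \<open>Level sets and Lorentz norms\<close>

lemma distr_fun_antimono: "s \<le> s' \<Longrightarrow> distr_fun g s' \<le> distr_fun g s"
  unfolding distr_fun_def by (intro emeasure_mono) auto

lemma distr_fun_mono: "(\<And>x. norm (f x) \<le> norm (g x)) \<Longrightarrow> distr_fun f s \<le> distr_fun g s"
  unfolding distr_fun_def by (intro emeasure_mono) (auto intro: less_le_trans ennreal_leI)

lemma decr_rearr_antimono: "t \<le> t' \<Longrightarrow> decr_rearr g t' \<le> decr_rearr g t"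
  unfolding decr_rearr_def by (intro Inf_superset_mono) (auto intro: order_trans ennreal_leI)

lemma decr_rearr_mono: "(\<And>x. norm (f x) \<le> norm (g x)) \<Longrightarrow> decr_rearr f t \<le> decr_rearr g t"
  unfolding decr_rearr_def by (intro Inf_superset_mono) (meson Collect_mono distr_fun_mono order_trans)

lemma decr_rearr_le: "distr_fun g s \<le> ennreal t \<Longrightarrow> decr_rearr g t \<le> s"
  unfolding decr_rearr_def by (intro Inf_lower) auto

lemma decr_rearr_ge: "ennreal t < distr_fun g s \<Longrightarrow> s \<le> decr_rearr g t"
  unfolding decr_rearr_def
  by (intro Inf_greatest) (metis distr_fun_antimono leD mem_Collect_eq nle_le order_trans)

lemma borel_measurable_decr_rearr [measurable]: "decr_rearr g \<in> borel_measurable borel"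
proof (rule borel_measurableI_greater)
  fix y
  define D where "D = {t. y < decr_rearr g t}"
  have down: "s \<in> D" if "t \<in> D" "s \<le> t" for s t
    using that decr_rearr_antimono[of s t g] by (auto simp: D_def)
  have "D \<in> sets borel"
  proof (cases "D = {} \<or> \<not> bdd_above D")
    case True
    then have "D = {} \<or> D = UNIV"
      using down by (auto simp: bdd_above_def not_le) (meson less_imp_le)
    then show ?thesis by auto
  next
    case False
    have "D = {..<Sup D} \<or> D = {..Sup D}"
    proof -
      have "{..<Sup D} \<subseteq> D"
        using False down by (meson lessThan_iff less_cSupE less_imp_le subsetI)
      moreover have "D \<subseteq> {..Sup D}"
        using False by (auto intro: cSup_upper)
      ultimately show ?thesis
        using down by (cases "Sup D \<in> D") (auto simp: less_le)
    qed
    then show ?thesis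
      by (metis borel_closed borel_open closed_atMost open_lessThan)
  qed
  then show "{x \<in> space borel. y < decr_rearr g x} \<in> sets borel"
    by (simp add: D_def)
qed

lemma distr_fun_finite: "finite {x. norm (g x) > s} \<Longrightarrow> 0 \<le> s \<Longrightarrow>
    distr_fun g (ennreal s) = ennreal (card {x. norm (g x) > s})"
  by (simp add: distr_fun_def ennreal_less_iff emeasure_count_space_finite ennreal_of_nat_eq_real_of_nat)

lemma nn_integral_powr_interval:
  fixes a m :: real
  assumes "0 < a" "0 \<le> m"
  shows "(\<integral>\<^sup>+t. ennreal (t powr a / t) * indicator {0<..<m} t \<partial>lborel) = ennreal (m powr a / a)"
proof -
  have "AE t in lborel. ennreal (t powr a / t) * indicator {0<..<m} t =
      ennreal (t powr (a - 1)) * indicator {0..m} t"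
    using AE_lborel_singleton[of m]
  proof eventually_elim
    case (elim t)
    then show ?case
      by (auto simp: indicator_def powr_diff)
  qed
  then have "(\<integral>\<^sup>+t. ennreal (t powr a / t) * indicator {0<..<m} t \<partial>lborel) =
      (\<integral>\<^sup>+t. ennreal (t powr (a - 1)) * indicator {0..m} t \<partial>lborel)"
    by (rule nn_integral_cong_AE)
  also have "\<dots> = ennreal (m powr (a - 1 + 1) / (a - 1 + 1))"
    using assms by (intro nn_integral_has_integral_lebesgue' has_integral_powr_from_0) auto
  finally show ?thesis by simp
qed

lemma lorentz_norm_mono:
  "(\<And>x. norm (f x) \<le> norm (g x)) \<Longrightarrow> lorentz_norm P f \<le> lorentz_norm P g"
  unfolding lorentz_norm_def
  by (intro mult_left_mono nn_integral_mono mult_right_mono decr_rearr_mono) auto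

text \<open>For each \<open>t\<close>, the dyadic levels whose level set has more than \<open>t\<close> elements are at most the
  rearrangement at \<open>t\<close>, and so their geometric sum is at most twice that value. Integration against
  \<open>t\<^sup>1\<^sup>/\<^sup>P / t\<close> turns each condition \<open>t < m\<close> into the power \<open>m\<^sup>1\<^sup>/\<^sup>P\<close>.\<close>

lemma dyadic_le_lorentz_norm:
  fixes f :: "'v \<Rightarrow> complex" and J :: "int set"
  assumes P: "0 < P" and J: "finite J" and fin: "\<And>j. j \<in> J \<Longrightarrow> finite {x. norm (f x) > 2 powr j}"
  shows "ennreal (\<Sum>j\<in>J. 2 powr j * real (card {x. norm (f x) > 2 powr j}) powr (1 / P)) \<le>
    2 * lorentz_norm P f"
proof -
  define m where "m = (\<lambda>j::int. real (card {x. norm (f x) > 2 powr j}))"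
  define w where "w = (\<lambda>t. ennreal (t powr (1 / P) / t))"
  have [measurable]: "w \<in> borel_measurable borel"
    unfolding w_def by measurable
  have level: "(\<Sum>j\<in>J. ennreal (2 powr j) * indicator {0<..<m j} t) \<le> 2 * decr_rearr f t" for t
  proof (cases "decr_rearr f t")
    case (real \<tau>)
    define J' where "J' = {j\<in>J. t \<in> {0<..<m j}}"
    have "2 powr j \<le> \<tau>" if "j \<in> J'" for j
    proof -
      have "ennreal t < distr_fun f (ennreal (2 powr j))"
        using that fin[of j] by (auto simp: J'_def distr_fun_finite m_def ennreal_less_iff)
      from decr_rearr_ge[OF this] real show ?thesis by simp
    qed
    then have "(\<Sum>j\<in>J'. 2 powr j) \<le> 2 / (2 - 1) * \<tau>"
      using J real by (intro sum_powr_int_le) (auto simp: J'_def)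
    moreover have "(\<Sum>j\<in>J. ennreal (2 powr j) * indicator {0<..<m j} t) = (\<Sum>j\<in>J'. ennreal (2 powr j))"
      using J by (intro sum.mono_neutral_cong_right) (auto simp: J'_def indicator_def)
    ultimately have "(\<Sum>j\<in>J. ennreal (2 powr j) * indicator {0<..<m j} t) \<le> ennreal (2 * \<tau>)"
      by (simp add: ennreal_leI)
    then show ?thesis
      using real by (simp add: ennreal_mult)
  qed (simp add: ennreal_mult_top)
  have "ennreal (\<Sum>j\<in>J. 2 powr j * m j powr (1 / P)) =
      (\<Sum>j\<in>J. ennreal (2 powr j) * (ennreal (1 / P) * ennreal (m j powr (1 / P) / (1 / P))))"
    using P by (simp add: m_def flip: ennreal_mult)
  also have "\<dots> = (\<Sum>j\<in>J. ennreal (2 powr j) * (ennreal (1 / P) * (\<integral>\<^sup>+t. w t * indicator {0<..<m j} t \<partial>lborel)))"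
    unfolding w_def using P by (subst nn_integral_powr_interval) (auto simp: m_def)
  also have "\<dots> = ennreal (1 / P) * (\<integral>\<^sup>+t. (\<Sum>j\<in>J. ennreal (2 powr j) * (w t * indicator {0<..<m j} t)) \<partial>lborel)"
    by (simp add: nn_integral_sum nn_integral_cmult sum_distrib_left mult.left_commute[of "ennreal (1 / P)"])
  also have "\<dots> \<le> ennreal (1 / P) * (\<integral>\<^sup>+t. 2 * (decr_rearr f t * w t * indicator {0<..} t) \<partial>lborel)"
  proof (intro mult_left_mono nn_integral_mono)
    fix t :: real
    show "(\<Sum>j\<in>J. ennreal (2 powr j) * (w t * indicator {0<..<m j} t)) \<le>
        2 * (decr_rearr f t * w t * indicator {0<..} t)"
    proof (cases "0 < t")
      case True
      have "(\<Sum>j\<in>J. ennreal (2 powr j) * (w t * indicator {0<..<m j} t)) =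
          (\<Sum>j\<in>J. ennreal (2 powr j) * indicator {0<..<m j} t) * w t"
        by (simp add: sum_distrib_left mult_ac)
      also have "\<dots> \<le> 2 * decr_rearr f t * w t"
        by (intro mult_right_mono level) auto
      finally show ?thesis
        using True by (simp add: mult_ac)
    qed simp
  qed auto
  also have "\<dots> = 2 * (ennreal (1 / P) * (\<integral>\<^sup>+t. decr_rearr f t * w t * indicator {0<..} t \<partial>lborel))"
    by (subst nn_integral_cmult) (auto simp: mult_ac)
  finally show ?thesis
    by (simp add: lorentz_norm_def m_def w_def)
qed

text \<open>For \<open>p < P\<close> Chebyshev's inequality turns the dyadic sum into a geometric sum; the top level is
  bounded by the norm because the counting measure has no sets of small positive measure.\<close>

lemma dyadic_le_Lp_norm:
  fixes f :: "'v \<Rightarrow> complex" and J :: "int set"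
  assumes p: "0 < p" "p < P" and J: "finite J"
    and fin: "\<And>j. j \<in> J \<Longrightarrow> finite {x. norm (f x) > 2 powr j}"
    and ne: "\<And>j. j \<in> J \<Longrightarrow> {x. norm (f x) > 2 powr j} \<noteq> {}"
  defines "b \<equiv> 2 powr (1 - p / P)"
  shows "ennreal (\<Sum>j\<in>J. 2 powr j * real (card {x. norm (f x) > 2 powr j}) powr (1 / P)) \<le>
    ennreal (b / (b - 1)) * Lp_norm (count_space UNIV) (ennreal p) f"
proof (cases "Lp_norm (count_space UNIV) (ennreal p) f")
  case (real M)
  define m where "m = (\<lambda>j::int. real (card {x. norm (f x) > 2 powr j}))"
  have b: "1 < b"
    unfolding b_def using p by (simp add: field_simps)
  have int: "(\<integral>\<^sup>+x. ennreal (norm (f x) powr p) \<partial>count_space UNIV) \<le> ennreal (M powr p)"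
    using Lp_norm_real_le_iff[of p M "count_space UNIV" f] real p by simp
  have chebyshev: "m j * (2 powr j) powr p \<le> M powr p" if "j \<in> J" for j
  proof -
    let ?F = "{x. norm (f x) > 2 powr j}"
    have "ennreal (m j * (2 powr j) powr p) = (\<integral>\<^sup>+x. ennreal ((2 powr j) powr p) * indicator ?F x \<partial>count_space UNIV)"
      using fin[OF that] by (simp add: nn_integral_cmult_indicator m_def ennreal_mult mult.commute
          ennreal_of_nat_eq_real_of_nat)
    also have "\<dots> \<le> (\<integral>\<^sup>+x. ennreal (norm (f x) powr p) \<partial>count_space UNIV)"
      using p by (intro nn_integral_mono) (auto simp: indicator_def intro!: ennreal_leI powr_mono2)
    also note int
    finally show ?thesis by simp
  qed
  have top_level: "2 powr j \<le> M" if "j \<in> J" for j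
  proof -
    have "1 \<le> m j"
      using fin[OF that] ne[OF that] by (simp add: m_def card_gt_0_iff Suc_le_eq)
    then have "1 * (2 powr j) powr p \<le> m j * (2 powr j) powr p"
      by (intro mult_right_mono) auto
    also note chebyshev[OF that]
    finally have "(2 powr j) powr p \<le> M powr p" by simp
    then show ?thesis
      using p real powr_less_mono2[of p M "2 powr j"] by (meson not_le)
  qed
  have b_powr: "b powr j = (2 powr j) powr (1 - p / P)" for j :: int
    by (simp add: b_def powr_powr mult.commute)
  have term_le: "2 powr j * m j powr (1 / P) \<le> M powr (p / P) * b powr j" if "j \<in> J" for j
  proof -
    have "m j powr (1 / P) = (m j * (2 powr j) powr p) powr (1 / P) * (2 powr j) powr (- (p / P))"
      using p by (simp add: powr_mult powr_powr mult.assoc flip: powr_add)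
    also have "\<dots> \<le> (M powr p) powr (1 / P) * (2 powr j) powr (- (p / P))"
      using chebyshev[OF that] p by (intro mult_right_mono powr_mono2) (auto simp: m_def)
    finally have "2 powr j * m j powr (1 / P) \<le>
        2 powr j * ((M powr p) powr (1 / P) * (2 powr j) powr (- (p / P)))"
      by (intro mult_left_mono) auto
    also have "\<dots> = M powr (p / P) * b powr j"
      by (simp add: b_powr powr_powr powr_diff powr_minus_divide divide_inverse algebra_simps)
    finally show ?thesis .
  qed
  have "(\<Sum>j\<in>J. 2 powr j * m j powr (1 / P)) \<le> (\<Sum>j\<in>J. M powr (p / P) * b powr j)"
    by (intro sum_mono term_le)
  also have "\<dots> = M powr (p / P) * (\<Sum>j\<in>J. b powr j)"
    by (simp add: sum_distrib_left)
  also have "\<dots> \<le> M powr (p / P) * (b / (b - 1) * M powr (1 - p / P))"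
    using b J p top_level by (intro mult_left_mono sum_powr_int_le) (auto simp: b_powr intro!: powr_mono2)
  also have "\<dots> = b / (b - 1) * M"
    using real by (simp add: mult_ac flip: powr_add)
  finally show ?thesis
    using b real by (simp add: m_def ennreal_leI flip: ennreal_mult)
next
  case top
  have "1 < b"
    unfolding b_def using p by (simp add: field_simps)
  then show ?thesis
    using top by (simp add: ennreal_mult_top)
qed

subsection \<open>Density of finitely supported functions\<close>

lemma ennreal_tendsto_0I:
  fixes u :: "nat \<Rightarrow> ennreal"
  assumes "\<And>e::real. 0 < e \<Longrightarrow> eventually (\<lambda>n. u n \<le> ennreal e) sequentially"
  shows "u \<longlonglongrightarrow> 0"
proof (rule order_tendstoI)
  fix a :: ennreal assume "0 < a"
  then obtain x where "0 < x" "x < a"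
    using dense by blast
  then obtain e where "0 < e" "ennreal e < a"
    by (cases x) auto
  then show "eventually (\<lambda>n. u n < a) sequentially"
    using assms[of e] by (auto elim: eventually_mono)
qed simp

lemma Lp_norm_tail_tendsto_0:
  fixes f :: "'v \<Rightarrow> complex" and B :: "nat \<Rightarrow> 'v set"
  assumes p: "0 < p" and B: "\<And>x. eventually (\<lambda>n. x \<in> B n) sequentially"
    and f: "Lp_norm (count_space UNIV) (ennreal p) f < \<infinity>"
  shows "(\<lambda>n. Lp_norm (count_space UNIV) (ennreal p) (\<lambda>x. if x \<in> B n then 0 else f x)) \<longlonglongrightarrow> 0"
proof (rule ennreal_tendsto_0I)
  fix e :: real assume e: "0 < e"
  let ?I = "\<lambda>n. \<integral>\<^sup>+x. ennreal (norm (if x \<in> B n then 0 else f x) powr p) \<partial>count_space UNIV"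
  obtain M where M: "Lp_norm (count_space UNIV) (ennreal p) f = ennreal M" "0 \<le> M"
    using f by (cases "Lp_norm (count_space UNIV) (ennreal p) f") auto
  then have "(\<integral>\<^sup>+x. ennreal (norm (f x) powr p) \<partial>count_space UNIV) \<le> ennreal (M powr p)"
    using Lp_norm_real_le_iff[of p M "count_space UNIV" f] p by simp
  then have "(\<integral>\<^sup>+x. ennreal (norm (f x) powr p) \<partial>count_space UNIV) < \<infinity>"
    by (rule le_less_trans) simp
  then have "?I \<longlonglongrightarrow> (\<integral>\<^sup>+x. 0 \<partial>(count_space UNIV :: 'v measure))"
  proof (intro nn_integral_dominated_convergence[where w = "\<lambda>x. ennreal (norm (f x) powr p)"] AE_I2)
    fix x
    show "(\<lambda>n. ennreal (norm (if x \<in> B n then 0 else f x) powr p)) \<longlonglongrightarrow> 0"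
      by (rule tendsto_eventually, rule eventually_mono[OF B[of x]]) simp
  qed auto
  then have "?I \<longlonglongrightarrow> 0" by simp
  then have "eventually (\<lambda>n. ?I n < ennreal (e powr p)) sequentially"
    using e by (intro order_tendstoD) auto
  then show "eventually (\<lambda>n. Lp_norm (count_space UNIV) (ennreal p) (\<lambda>x. if x \<in> B n then 0 else f x) \<le> ennreal e) sequentially"
    by (rule eventually_mono) (use e p in \<open>intro Lp_norm_leI, auto\<close>)
qed

text \<open>An infinite level set bounds the rearrangement below by a positive constant, against which the
  weight \<open>t\<^sup>1\<^sup>/\<^sup>P / t\<close> is not integrable at infinity.\<close>

lemma lorentz_norm_finite_levels:
  fixes f :: "'v \<Rightarrow> complex"
  assumes P: "0 < P" and f: "lorentz_norm P f < \<infinity>" and e: "0 < e"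
  shows "finite {x. norm (f x) > e}"
proof (rule ccontr)
  assume inf: "infinite {x. norm (f x) > e}"
  have "distr_fun f (ennreal e) = \<infinity>"
    using inf e by (simp add: distr_fun_def ennreal_less_iff)
  then have ge: "ennreal e \<le> decr_rearr f t" for t
    by (intro decr_rearr_ge) auto
  have big: "ennreal (e * m powr (1 / P)) \<le> lorentz_norm P f" if "0 \<le> m" for m
  proof -
    have "ennreal (e * m powr (1 / P)) =
        ennreal (1 / P) * (ennreal e * ennreal (m powr (1 / P) / (1 / P)))"
      using P e by (simp flip: ennreal_mult)
    also have "\<dots> = ennreal (1 / P) * (\<integral>\<^sup>+t. ennreal e * (ennreal (t powr (1 / P) / t) * indicator {0<..<m} t) \<partial>lborel)"
      using P that by (subst nn_integral_powr_interval[symmetric]) (auto simp: nn_integral_cmult)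
    also have "\<dots> \<le> lorentz_norm P f"
      unfolding lorentz_norm_def using ge
      by (intro mult_left_mono nn_integral_mono) (auto simp: indicator_def intro!: mult_right_mono)
    finally show ?thesis .
  qed
  obtain L where L: "lorentz_norm P f = ennreal L" "0 \<le> L"
    using f by (cases "lorentz_norm P f") auto
  have "ennreal (e * (((L + 1) / e) powr P) powr (1 / P)) \<le> ennreal L"
    using big[of "((L + 1) / e) powr P"] L by simp
  then have "L + 1 \<le> L"
    using P e L by (simp add: powr_powr)
  then show False by simp
qed

lemma lorentz_norm_tail_tendsto_0:
  fixes f :: "'v \<Rightarrow> complex" and B :: "nat \<Rightarrow> 'v set"
  assumes P: "0 < P" and B: "\<And>x. eventually (\<lambda>n. x \<in> B n) sequentially"
    and f: "lorentz_norm P f < \<infinity>"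
  shows "(\<lambda>n. lorentz_norm P (\<lambda>x. if x \<in> B n then 0 else f x)) \<longlonglongrightarrow> 0"
proof -
  define g where "g = (\<lambda>n x. if x \<in> B n then 0 else f x)"
  define w where "w = (\<lambda>t. ennreal (t powr (1 / P) / t) * indicator {0<..} t)"
  have [measurable]: "w \<in> borel_measurable borel"
    unfolding w_def by measurable
  have norm_eq: "lorentz_norm P h = ennreal (1 / P) * (\<integral>\<^sup>+t. decr_rearr h t * w t \<partial>lborel)" for h :: "'v \<Rightarrow> complex"
    by (simp add: lorentz_norm_def w_def mult.assoc)
  have "(\<integral>\<^sup>+t. decr_rearr f t * w t \<partial>lborel) < \<infinity>"
    using f P by (auto simp: norm_eq ennreal_mult_less_top)
  moreover have "(\<lambda>n. decr_rearr (g n) t * w t) \<longlonglongrightarrow> 0" for t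
  proof (cases "0 < t")
    case True
    have "(\<lambda>n. decr_rearr (g n) t) \<longlonglongrightarrow> 0"
    proof (rule ennreal_tendsto_0I)
      fix e :: real assume e: "0 < e"
      have "eventually (\<lambda>n. \<forall>x\<in>{x. norm (f x) > e}. x \<in> B n) sequentially"
        using lorentz_norm_finite_levels[OF P f e] B by (intro eventually_ball_finite) auto
      then show "eventually (\<lambda>n. decr_rearr (g n) t \<le> ennreal e) sequentially"
      proof (rule eventually_mono)
        fix n assume "\<forall>x\<in>{x. norm (f x) > e}. x \<in> B n"
        then have "{x. ennreal e < ennreal (norm (g n x))} = {}"
          using e by (auto simp: g_def ennreal_less_iff)
        then show "decr_rearr (g n) t \<le> ennreal e"
          by (intro decr_rearr_le) (simp add: distr_fun_def)
      qed
    qed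
    then have "(\<lambda>n. decr_rearr (g n) t * ennreal (t powr (1 / P) / t)) \<longlonglongrightarrow> 0 * ennreal (t powr (1 / P) / t)"
      by (intro tendsto_mult_ennreal tendsto_const) auto
    then show ?thesis
      using True by (simp add: w_def)
  qed (simp add: w_def)
  moreover have "decr_rearr (g n) t * w t \<le> decr_rearr f t * w t" for n t
    by (intro mult_right_mono decr_rearr_mono) (auto simp: g_def)
  ultimately have "(\<lambda>n. \<integral>\<^sup>+t. decr_rearr (g n) t * w t \<partial>lborel) \<longlonglongrightarrow> (\<integral>\<^sup>+t. 0 \<partial>(lborel :: real measure))"
    by (intro nn_integral_dominated_convergence[where w = "\<lambda>t. decr_rearr f t * w t"] AE_I2) auto
  then have "(\<lambda>n. ennreal (1 / P) * (\<integral>\<^sup>+t. decr_rearr (g n) t * w t \<partial>lborel)) \<longlonglongrightarrow> ennreal (1 / P) * 0"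
    by (intro tendsto_mult_ennreal tendsto_const) auto
  then show ?thesis
    by (simp add: norm_eq g_def)
qed

section \<open>The Poisson kernel on characteristic functions\<close>

text \<open>Here \<open>\<eta>\<close> is \<open>1 - 1 / P\<close>. Of the power \<open>1 - 1 / \<rho>\<close> of the minimum, the part \<open>\<eta>\<close> is spent on
  \<open>2 Q\<^sup>k\<close> and the rest on \<open>m\<close>; since \<open>\<eta> < 1 / \<rho>\<close>, the series over \<open>k\<close> still converges.\<close>

lemma level_series_interior:
  fixes Q \<rho> \<eta> :: real
  assumes Q: "1 < Q" and \<rho>: "1 < \<rho>" and \<eta>: "0 \<le> \<eta>" "\<eta> \<le> 1 - 1 / \<rho>" "\<eta> < 1 / \<rho>"
  shows "\<exists>C>0. \<forall>m K. 1 \<le> m \<longrightarrow>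
    (\<Sum>k\<le>(K::nat). Q powr (- (k / \<rho>)) * min (2 * Q ^ k) m powr (1 - 1 / \<rho>) * m powr (1 / \<rho>)) \<le>
      C * m powr (1 - \<eta>)"
proof -
  define b where "b = Q powr (1 / \<rho> - \<eta>)"
  have b: "1 < b"
    unfolding b_def using Q \<eta> by (intro gr_one_powr) auto
  show ?thesis
  proof (intro exI[of _ "2 powr \<eta> * (b / (b - 1))"] conjI allI impI)
    fix m :: real and K :: nat assume m: "1 \<le> m"
    have "(\<Sum>k\<le>K. Q powr (- (k / \<rho>)) * min (2 * Q ^ k) m powr (1 - 1 / \<rho>) * m powr (1 / \<rho>)) \<le>
        (\<Sum>k\<le>K. 2 powr \<eta> * m powr (1 - \<eta>) * b powr real_of_int (- int k))"
    proof (rule sum_mono)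
      fix k
      have pos: "0 < 2 * Q ^ k"
        using Q by simp
      have "min (2 * Q ^ k) m powr (1 - 1 / \<rho>) =
          min (2 * Q ^ k) m powr \<eta> * min (2 * Q ^ k) m powr (1 - 1 / \<rho> - \<eta>)"
        by (simp flip: powr_add)
      also have "\<dots> \<le> (2 * Q ^ k) powr \<eta> * m powr (1 - 1 / \<rho> - \<eta>)"
        using \<eta> m pos by (intro mult_mono powr_mono2) auto
      also have "(2 * Q ^ k) powr \<eta> = 2 powr \<eta> * Q powr (k * \<eta>)"
        using Q by (simp add: powr_mult powr_powr flip: powr_realpow)
      finally have "Q powr (- (k / \<rho>)) * min (2 * Q ^ k) m powr (1 - 1 / \<rho>) * m powr (1 / \<rho>) \<le>
          Q powr (- (k / \<rho>)) * (2 powr \<eta> * Q powr (k * \<eta>) * m powr (1 - 1 / \<rho> - \<eta>)) * m powr (1 / \<rho>)"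
        by (intro mult_right_mono mult_left_mono) auto
      also have "\<dots> = 2 powr \<eta> * (m powr (1 - 1 / \<rho> - \<eta>) * m powr (1 / \<rho>)) *
          (Q powr (- (k / \<rho>)) * Q powr (k * \<eta>))"
        by simp
      also have "m powr (1 - 1 / \<rho> - \<eta>) * m powr (1 / \<rho>) = m powr (1 - \<eta>)"
        by (simp flip: powr_add)
      also have "Q powr (- (k / \<rho>)) * Q powr (k * \<eta>) = b powr real_of_int (- int k)"
        by (simp add: b_def powr_powr algebra_simps flip: powr_add)
      finally show "Q powr (- (k / \<rho>)) * min (2 * Q ^ k) m powr (1 - 1 / \<rho>) * m powr (1 / \<rho>) \<le>
          2 powr \<eta> * m powr (1 - \<eta>) * b powr real_of_int (- int k)" .
    qed
    also have "\<dots> = 2 powr \<eta> * m powr (1 - \<eta>) * (\<Sum>j\<in>(\<lambda>k. - int k) ` {..K}. b powr j)"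
      by (subst sum.reindex) (auto simp: inj_on_def sum_distrib_left)
    also have "\<dots> \<le> 2 powr \<eta> * m powr (1 - \<eta>) * (b / (b - 1) * 1)"
    proof (intro mult_left_mono sum_powr_int_le[OF b])
      fix j assume "j \<in> (\<lambda>k. - int k) ` {..K}"
      then have "b powr j \<le> b powr 0"
        using b by (intro powr_mono) auto
      then show "b powr j \<le> 1"
        using b by simp
    qed auto
    finally show "(\<Sum>k\<le>K. Q powr (- (k / \<rho>)) * min (2 * Q ^ k) m powr (1 - 1 / \<rho>) * m powr (1 / \<rho>)) \<le>
      2 powr \<eta> * (b / (b - 1)) * m powr (1 - \<eta>)"
      by (simp add: mult_ac)
  qed (use b in auto)
qed

text \<open>At the end point \<open>\<eta> = 1 / \<rho>\<close> the interpolated series would diverge. Instead the sum is split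
  where \<open>Q\<^sup>k = m\<close>: for \<open>\<rho> > 2\<close> the terms increase geometrically up to this point and decrease
  geometrically after it.\<close>

lemma level_series_endpoint:
  fixes Q \<rho> :: real
  assumes Q: "1 < Q" and \<rho>: "2 < \<rho>"
  shows "\<exists>C>0. \<forall>m K. 1 \<le> m \<longrightarrow>
    (\<Sum>k\<le>(K::nat). Q powr (- (k / \<rho>)) * min (2 * Q ^ k) m powr (1 - 1 / \<rho>) * m powr (1 / \<rho>)) \<le>
      C * m powr (1 - 1 / \<rho>)"
proof -
  define \<alpha> where "\<alpha> = 1 - 2 / \<rho>"
  define b where "b = Q powr \<alpha>"
  define d where "d = Q powr (1 / \<rho>)"
  have b: "1 < b"
    unfolding b_def \<alpha>_def using Q \<rho> by (intro gr_one_powr) auto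
  have d: "1 < d"
    unfolding d_def using Q \<rho> by (intro gr_one_powr) auto
  show ?thesis
  proof (intro exI[of _ "2 * (b / (b - 1)) + d / (d - 1)"] conjI allI impI)
    fix m :: real and K :: nat assume m: "1 \<le> m"
    let ?t = "\<lambda>k::nat. Q powr (- (k / \<rho>)) * min (2 * Q ^ k) m powr (1 - 1 / \<rho>) * m powr (1 / \<rho>)"
    define L where "L = {k. k \<le> K \<and> Q ^ k \<le> m}"
    define R where "R = {k. k \<le> K \<and> m < Q ^ k}"
    have [simp]: "finite L" "finite R"
      by (auto simp: L_def R_def)
    have "{..K} = L \<union> R" "L \<inter> R = {}"
      by (auto simp: L_def R_def)
    then have split: "(\<Sum>k\<le>K. ?t k) = (\<Sum>k\<in>L. ?t k) + (\<Sum>k\<in>R. ?t k)"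
      by (simp add: sum.union_disjoint)
    have "(\<Sum>k\<in>L. ?t k) \<le> (\<Sum>k\<in>L. 2 * m powr (1 / \<rho>) * b powr real_of_int (int k))"
    proof (rule sum_mono)
      fix k
      have "min (2 * Q ^ k) m powr (1 - 1 / \<rho>) \<le> (2 * Q ^ k) powr (1 - 1 / \<rho>)"
        using Q m \<rho> by (intro powr_mono2) auto
      also have "\<dots> = 2 powr (1 - 1 / \<rho>) * Q powr (k * (1 - 1 / \<rho>))"
        using Q by (simp add: powr_mult powr_powr flip: powr_realpow)
      also have "\<dots> \<le> 2 powr 1 * Q powr (k * (1 - 1 / \<rho>))"
        using \<rho> by (intro mult_right_mono powr_mono) auto
      finally have "?t k \<le> Q powr (- (k / \<rho>)) * (2 powr 1 * Q powr (k * (1 - 1 / \<rho>))) * m powr (1 / \<rho>)"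
        by (intro mult_right_mono mult_left_mono) auto
      also have "\<dots> = 2 * m powr (1 / \<rho>) * (Q powr (- (k / \<rho>)) * Q powr (k * (1 - 1 / \<rho>)))"
        by simp
      also have "Q powr (- (k / \<rho>)) * Q powr (k * (1 - 1 / \<rho>)) = b powr real_of_int (int k)"
        by (simp add: b_def \<alpha>_def powr_powr algebra_simps flip: powr_add)
      finally show "?t k \<le> 2 * m powr (1 / \<rho>) * b powr real_of_int (int k)" .
    qed
    also have "\<dots> = 2 * m powr (1 / \<rho>) * (\<Sum>j\<in>int ` L. b powr j)"
      by (subst sum.reindex) (auto simp: sum_distrib_left)
    also have "\<dots> \<le> 2 * m powr (1 / \<rho>) * (b / (b - 1) * m powr \<alpha>)"
    proof (intro mult_left_mono sum_powr_int_le[OF b])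
      fix j assume "j \<in> int ` L"
      then obtain k where k: "j = int k" "Q ^ k \<le> m"
        by (auto simp: L_def)
      have "b powr j = (Q ^ k) powr \<alpha>"
        using Q k by (simp add: b_def powr_powr mult.commute flip: powr_realpow)
      also have "\<dots> \<le> m powr \<alpha>"
        using k Q \<rho> by (intro powr_mono2) (auto simp: \<alpha>_def)
      finally show "b powr j \<le> m powr \<alpha>" .
    qed auto
    also have "\<dots> = 2 * (b / (b - 1)) * m powr (1 - 1 / \<rho>)"
      by (simp add: \<alpha>_def mult.left_commute flip: powr_add)
    finally have low: "(\<Sum>k\<in>L. ?t k) \<le> 2 * (b / (b - 1)) * m powr (1 - 1 / \<rho>)" .
    have "(\<Sum>k\<in>R. ?t k) \<le> (\<Sum>k\<in>R. m * d powr real_of_int (- int k))"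
    proof (rule sum_mono)
      fix k
      have "min (2 * Q ^ k) m powr (1 - 1 / \<rho>) \<le> m powr (1 - 1 / \<rho>)"
        using Q m \<rho> by (intro powr_mono2) auto
      then have "?t k \<le> Q powr (- (k / \<rho>)) * m powr (1 - 1 / \<rho>) * m powr (1 / \<rho>)"
        by (intro mult_right_mono mult_left_mono) auto
      also have "\<dots> = m * d powr real_of_int (- int k)"
        using m by (simp add: d_def powr_powr mult.assoc flip: powr_add)
      finally show "?t k \<le> m * d powr real_of_int (- int k)" .
    qed
    also have "\<dots> = m * (\<Sum>j\<in>(\<lambda>k. - int k) ` R. d powr j)"
      by (subst sum.reindex) (auto simp: inj_on_def sum_distrib_left)
    also have "\<dots> \<le> m * (d / (d - 1) * m powr (- (1 / \<rho>)))"
    proof (intro mult_left_mono sum_powr_int_le[OF d])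
      fix j assume "j \<in> (\<lambda>k. - int k) ` R"
      then obtain k where k: "j = - int k" "m < Q ^ k"
        by (auto simp: R_def)
      have "d powr j = (Q ^ k) powr (- (1 / \<rho>))"
        using Q k by (simp add: d_def powr_powr flip: powr_realpow)
      also have "\<dots> \<le> m powr (- (1 / \<rho>))"
        using k m \<rho> by (intro powr_mono2') auto
      finally show "d powr j \<le> m powr (- (1 / \<rho>))" .
    qed (use m in auto)
    also have "\<dots> = d / (d - 1) * m powr (1 - 1 / \<rho>)"
      using m by (simp add: powr_diff powr_minus_divide)
    finally have high: "(\<Sum>k\<in>R. ?t k) \<le> d / (d - 1) * m powr (1 - 1 / \<rho>)" .
    show "(\<Sum>k\<le>K. ?t k) \<le> (2 * (b / (b - 1)) + d / (d - 1)) * m powr (1 - 1 / \<rho>)"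
      unfolding split distrib_right by (rule add_mono[OF low high])
  qed (use b d in \<open>auto intro!: add_pos_pos\<close>)
qed

context rooted_tree
begin

subsection \<open>The kernel as a combination of cylinders\<close>

text \<open>Summation by parts along the geodesic: a function of the height is a combination of indicators
  of cylinders.\<close>

lemma height_function_expansion:
  fixes \<phi> :: "int \<Rightarrow> 'a::comm_ring_1"
  assumes "\<omega> \<in> Omega"
  shows "\<phi> (height adj v0 \<omega> x) = \<phi> (- int (lev x)) +
    (\<Sum>i<lev x. (\<phi> (2 * int (Suc i) - int (lev x)) - \<phi> (2 * int i - int (lev x))) *
      indicator (E (ancestor (lev x - Suc i) x)) \<omega>)"
proof -
  obtain j where j: "j \<le> lev x" "height adj v0 \<omega> x = 2 * int j - int (lev x)"
    and ind: "\<And>i. i \<le> lev x \<Longrightarrow> \<omega> \<in> E (ancestor (lev x - i) x) \<longleftrightarrow> i \<le> j"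
    using height_cases[OF assms, of x] by blast
  define \<psi> where "\<psi> = (\<lambda>i. \<phi> (2 * int i - int (lev x)))"
  have "(\<Sum>i<lev x. (\<psi> (Suc i) - \<psi> i) * indicator (E (ancestor (lev x - Suc i) x)) \<omega>) =
      (\<Sum>i<j. \<psi> (Suc i) - \<psi> i)"
    using j ind by (intro sum.mono_neutral_cong_right) (auto simp: indicator_def Suc_le_eq)
  also have "\<dots> = \<psi> j - \<psi> 0"
    by (simp add: sum_lessThan_telescope)
  finally show ?thesis
    using j by (simp add: \<psi>_def)
qed

lemma borel_measurable_height_function:
  fixes \<phi> :: "int \<Rightarrow> 'a::{real_normed_field, second_countable_topology}"
  shows "(\<lambda>\<omega>. \<phi> (height adj v0 \<omega> x)) \<in> borel_measurable \<nu>"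
proof -
  have "(\<lambda>\<omega>. \<phi> (- int (lev x)) +
    (\<Sum>i<lev x. (\<phi> (2 * int (Suc i) - int (lev x)) - \<phi> (2 * int i - int (lev x))) *
      indicator (E (ancestor (lev x - Suc i) x)) \<omega>)) \<in> borel_measurable \<nu>"
    by measurable
  then show ?thesis
    by (subst measurable_cong[OF height_function_expansion]) (auto simp: space_nu)
qed

definition kernel :: "real \<Rightarrow> 'v \<Rightarrow> (nat \<Rightarrow> 'v) \<Rightarrow> real" where
  "kernel s x \<omega> = real q powr (s * height adj v0 \<omega> x)"

lemma kernel_nonneg: "0 \<le> kernel s x \<omega>"
  by (simp add: kernel_def)

lemma borel_measurable_kernel [measurable]: "kernel s x \<in> borel_measurable \<nu>"
  using borel_measurable_height_function[of "\<lambda>h. real q powr (s * h)" x] by (simp add: kernel_def[abs_def])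

lemma borel_measurable_poisson_power [measurable]: "poisson_power q adj v0 w x \<in> borel_measurable \<nu>"
  using borel_measurable_height_function[of "\<lambda>h. of_nat q powr (w * of_int h)" x]
  by (simp add: poisson_power_def[abs_def])

lemma norm_poisson_power: "norm (poisson_power q adj v0 w x \<omega>) = kernel (Re w) x \<omega>"
  using q_ge_2 by (simp add: poisson_power_def kernel_def norm_powr_real_powr)

lemma emeasure_Omega_le: "emeasure \<nu> Omega \<le> 1"
proof -
  have "E v0 = Omega"
    by (auto simp: cylinder_def lev_root boundary_def)
  then show ?thesis
    using emeasure_cylinder_le[of v0] by simp
qed

text \<open>The expansion into cylinders has nonnegative coefficients, and the bounds for their measures
  add up to exactly 1.\<close>

lemma nn_integral_kernel_le_1: "(\<integral>\<^sup>+\<omega>. ennreal (kernel 1 x \<omega>) \<partial>\<nu>) \<le> 1"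
proof -
  define n where "n = lev x"
  define Q where "Q = real q"
  have Q: "2 \<le> Q"
    using q_ge_2 by (simp add: Q_def)
  define c where "c = (\<lambda>i::nat. Q powr (2 * real (Suc i) - n) - Q powr (2 * real i - n))"
  define D where "D = (\<lambda>i. E (ancestor (n - Suc i) x))"
  have [measurable]: "D i \<in> sets \<nu>" for i
    by (simp add: D_def)
  have c: "0 \<le> c i" for i
    unfolding c_def using Q by (simp add: powr_mono)
  have "(\<integral>\<^sup>+\<omega>. ennreal (kernel 1 x \<omega>) \<partial>\<nu>) =
      (\<integral>\<^sup>+\<omega>. ennreal (Q powr (- real n)) + (\<Sum>i<n. ennreal (c i) * indicator (D i) \<omega>) \<partial>\<nu>)"
  proof (rule nn_integral_cong)
    fix \<omega> assume "\<omega> \<in> space \<nu>"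
    then have "kernel 1 x \<omega> = Q powr (- real n) + (\<Sum>i<n. c i * indicator (D i) \<omega>)"
      using height_function_expansion[of \<omega> "\<lambda>h. Q powr h" x]
      by (simp add: space_nu kernel_def c_def D_def n_def Q_def)
    also have "ennreal \<dots> = ennreal (Q powr (- real n)) + (\<Sum>i<n. ennreal (c i) * indicator (D i) \<omega>)"
      using c by (subst ennreal_plus) (auto intro!: sum_nonneg sum.cong simp: indicator_def simp flip: sum_ennreal)
    finally show "ennreal (kernel 1 x \<omega>) =
        ennreal (Q powr (- real n)) + (\<Sum>i<n. ennreal (c i) * indicator (D i) \<omega>)" .
  qed
  also have "\<dots> = ennreal (Q powr (- real n)) * emeasure \<nu> Omega + (\<Sum>i<n. ennreal (c i) * emeasure \<nu> (D i))"
  proof -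
    have "(\<integral>\<^sup>+\<omega>. (\<Sum>i<n. ennreal (c i) * indicator (D i) \<omega>) \<partial>\<nu>) = (\<Sum>i<n. ennreal (c i) * emeasure \<nu> (D i))"
      by (subst nn_integral_sum) (auto simp: nn_integral_cmult_indicator)
    moreover have "(\<lambda>\<omega>. \<Sum>i<n. ennreal (c i) * indicator (D i) \<omega>) \<in> borel_measurable \<nu>"
      by measurable
    ultimately show ?thesis
      by (subst nn_integral_add) (simp_all add: space_nu del: sum_mult_indicator)
  qed
  also have "\<dots> \<le> ennreal (Q powr (- real n)) * 1 + (\<Sum>i<n. ennreal (c i) * ennreal (Q / ((Q + 1) * Q ^ Suc i)))"
  proof (intro add_mono mult_left_mono sum_mono emeasure_Omega_le)
    fix i assume "i \<in> {..<n}"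
    then have "lev (ancestor (n - Suc i) x) = Suc i"
      by (simp add: n_def lev_ancestor)
    then show "emeasure \<nu> (D i) \<le> ennreal (Q / ((Q + 1) * Q ^ Suc i))"
      using emeasure_cylinder_le[of "ancestor (n - Suc i) x"]
      by (auto simp: D_def lev_root Q_def add.commute split: if_splits)
  qed auto
  also have "\<dots> = ennreal (Q powr (- real n) + (\<Sum>i<n. c i * (Q / ((Q + 1) * Q ^ Suc i))))"
    using c Q by (subst ennreal_plus) (auto intro!: sum_nonneg simp: simp flip: sum_ennreal ennreal_mult)
  also have "(\<Sum>i<n. c i * (Q / ((Q + 1) * Q ^ Suc i))) = (\<Sum>i<n. Q powr (- real n) * (Q - 1) * Q ^ i)"
  proof (rule sum.cong[OF refl])
    fix i
    have "Q powr (2 * real j - n) = Q powr (- real n) * Q ^ (2 * j)" for j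
    proof -
      have "2 * real j - real n = - real n + real (2 * j)" by simp
      moreover have "Q powr real (2 * j) = Q ^ (2 * j)"
        using Q by (intro powr_realpow) simp
      ultimately show ?thesis
        by (simp only: powr_add)
    qed
    then have "c i = Q powr (- real n) * (Q ^ (2 * Suc i) - Q ^ (2 * i))"
      unfolding c_def by (simp only: right_diff_distrib)
    also have "Q ^ (2 * Suc i) - Q ^ (2 * i) = (Q - 1) * (Q + 1) * (Q ^ i * Q ^ i)"
      by (simp add: algebra_simps mult_2 mult_2_right power_add)
    finally have "c i = Q powr (- real n) * (Q - 1) * (Q + 1) * (Q ^ i * Q ^ i)"
      by simp
    then show "c i * (Q / ((Q + 1) * Q ^ Suc i)) = Q powr (- real n) * (Q - 1) * Q ^ i"
      using Q by (simp add: divide_simps)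
  qed
  also have "\<dots> = Q powr (- real n) * ((Q - 1) * (\<Sum>i<n. Q ^ i))"
    by (simp add: sum_distrib_left mult.assoc)
  also have "(Q - 1) * (\<Sum>i<n. Q ^ i) = Q ^ n - 1"
    by (rule power_diff_1_eq[symmetric])
  also have "Q powr (- real n) + Q powr (- real n) * (Q ^ n - 1) = 1"
    using Q by (simp add: right_diff_distrib powr_minus powr_realpow)
  finally show ?thesis by simp
qed

text \<open>This is the case \<open>p = 1\<close> of the theorem on point masses.\<close>

lemma Lp_norm_kernel_le_1:
  assumes "1 \<le> r"
  shows "Lp_norm \<nu> r (\<lambda>\<omega>. of_real (kernel (enn2real (inverse r)) x \<omega>)) \<le> 1"
  using assms
proof (cases rule: exponent_cases)
  case top
  have "Lp_norm \<nu> \<infinity> (\<lambda>\<omega>. of_real (kernel 0 x \<omega>)) \<le> 1"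
    using q_ge_2 by (subst Lp_norm_infinity_le_iff) (auto simp: kernel_def)
  then show ?thesis
    using top by simp
next
  case (real \<rho>)
  then have s: "enn2real (inverse r) = 1 / \<rho>"
    by (simp add: inverse_ennreal divide_inverse)
  have "norm (complex_of_real (kernel (1 / \<rho>) x \<omega>)) powr \<rho> = kernel 1 x \<omega>" for \<omega>
    using real by (simp add: kernel_def powr_powr)
  then have "Lp_norm \<nu> (ennreal \<rho>) (\<lambda>\<omega>. of_real (kernel (1 / \<rho>) x \<omega>)) \<le> ennreal 1"
    using real nn_integral_kernel_le_1[of x] by (intro Lp_norm_leI) simp_all
  then show ?thesis
    unfolding s using real by simp
qed

subsection \<open>Decomposition by the distance to the ray\<close>

lemma lev_bounded:
  assumes "finite F"
  shows "\<exists>K. \<forall>x\<in>F. lev x \<le> K"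
  using assms finite_nat_set_iff_bounded_le[of "lev ` F"] by simp

text \<open>The part of the kernel, summed over \<open>F\<close>, that comes from vertices at distance \<open>k\<close> from the
  ray. The indicator only says that the ray passes through the \<open>k\<close>-th ancestor, not that it leaves
  the geodesic there, so this is an upper bound for that part.\<close>

definition level_sum :: "real \<Rightarrow> 'v set \<Rightarrow> nat \<Rightarrow> (nat \<Rightarrow> 'v) \<Rightarrow> real" where
  "level_sum s F k \<omega> = (\<Sum>x\<in>F. if k \<le> lev x
     then real q powr (s * (real (lev x) - 2 * real k)) * indicator (E (ancestor k x)) \<omega> else 0)"

lemma borel_measurable_level_sum [measurable]: "level_sum s F k \<in> borel_measurable \<nu>"
  unfolding level_sum_def[abs_def] by measurable

lemma level_sum_nonneg: "0 \<le> level_sum s F k \<omega>"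
  unfolding level_sum_def by (intro sum_nonneg) auto

lemma kernel_sum_le_level_sums:
  assumes \<omega>: "\<omega> \<in> Omega" and K: "\<And>x. x \<in> F \<Longrightarrow> lev x \<le> K"
  shows "(\<Sum>x\<in>F. kernel s x \<omega>) \<le> (\<Sum>k\<le>K. level_sum s F k \<omega>)"
proof -
  let ?t = "\<lambda>x k. if k \<le> lev x
     then real q powr (s * (real (lev x) - 2 * real k)) * indicator (E (ancestor k x)) \<omega> else 0"
  have "kernel s x \<omega> \<le> (\<Sum>k\<le>K. ?t x k)" if "x \<in> F" for x
  proof -
    obtain j where j: "j \<le> lev x" "height adj v0 \<omega> x = 2 * int j - int (lev x)"
      "\<omega> \<in> E (ancestor (lev x - j) x)"
      using height_cases[OF \<omega>, of x] by auto
    have "kernel s x \<omega> = ?t x (lev x - j)"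
      using j by (simp add: kernel_def of_nat_diff)
    also have "\<dots> \<le> (\<Sum>k\<le>K. ?t x k)"
      using K[OF that] by (intro member_le_sum) auto
    finally show ?thesis .
  qed
  then have "(\<Sum>x\<in>F. kernel s x \<omega>) \<le> (\<Sum>x\<in>F. \<Sum>k\<le>K. ?t x k)"
    by (rule sum_mono)
  also have "\<dots> = (\<Sum>k\<le>K. level_sum s F k \<omega>)"
    unfolding level_sum_def by (rule sum.swap)
  finally show ?thesis .
qed

text \<open>Grouping by the position \<open>j\<close> of the ancestor on the ray, with the number of
  descendants in \<open>F\<close> as coefficient.\<close>

lemma level_sum_eq:
  assumes \<omega>: "\<omega> \<in> Omega" and "finite F" and K: "\<And>x. x \<in> F \<Longrightarrow> lev x \<le> K"
  shows "level_sum s F k \<omega> = real q powr (- s * k) *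
    (\<Sum>j<Suc K. (real q powr s) ^ j * real (card (F \<inter> descendants k (\<omega> j))))"
proof -
  have q: "0 < real q"
    using q_ge_2 by simp
  have "(\<Sum>j<Suc K. (real q powr s) ^ j * real (card (F \<inter> descendants k (\<omega> j)))) =
      (\<Sum>j<Suc K. \<Sum>x\<in>F. (real q powr s) ^ j * (if x \<in> descendants k (\<omega> j) then 1 else 0))"
    using \<open>finite F\<close> by (simp add: sum.If_cases flip: sum_distrib_left del: sum.lessThan_Suc)
  also have "\<dots> = (\<Sum>x\<in>F. \<Sum>j<Suc K. (real q powr s) ^ j * (if x \<in> descendants k (\<omega> j) then 1 else 0))"
    by (rule sum.swap)
  finally have "real q powr (- s * k) *
      (\<Sum>j<Suc K. (real q powr s) ^ j * real (card (F \<inter> descendants k (\<omega> j)))) =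
      (\<Sum>x\<in>F. real q powr (- s * k) *
        (\<Sum>j<Suc K. (real q powr s) ^ j * (if x \<in> descendants k (\<omega> j) then 1 else 0)))"
    by (simp add: sum_distrib_left)
  also have "\<dots> = level_sum s F k \<omega>"
    unfolding level_sum_def
  proof (rule sum.cong[OF refl])
    fix x assume x: "x \<in> F"
    have mem: "x \<in> descendants k (\<omega> j) \<longleftrightarrow> lev x = j + k \<and> ancestor k x = \<omega> j" for j
      by (simp add: descendants_def lev_ray[OF \<omega>])
    show "real q powr (- s * k) *
        (\<Sum>j<Suc K. (real q powr s) ^ j * (if x \<in> descendants k (\<omega> j) then 1 else 0)) =
      (if k \<le> lev x then real q powr (s * (real (lev x) - 2 * real k)) *
        indicator (E (ancestor k x)) \<omega> else 0)"
    proof (cases "k \<le> lev x")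
      case True
      define j0 where "j0 = lev x - k"
      have j0: "lev x = j0 + k" "j0 < Suc K"
        using True K[OF x] by (auto simp: j0_def)
      have "(\<Sum>j<Suc K. (real q powr s) ^ j * (if x \<in> descendants k (\<omega> j) then 1 else 0)) =
          (\<Sum>j<Suc K. if j = j0 then (real q powr s) ^ j0 * indicator (E (ancestor k x)) \<omega> else 0)"
      proof (rule sum.cong[OF refl])
        fix j
        have "\<omega> \<in> E (ancestor k x) \<longleftrightarrow> ancestor k x = \<omega> j0"
          using \<omega> True by (auto simp: mem_cylinder lev_ancestor j0_def)
        moreover have "x \<in> descendants k (\<omega> j) \<longleftrightarrow> j = j0 \<and> ancestor k x = \<omega> j0"
          unfolding mem j0(1) by auto
        ultimately show "(real q powr s) ^ j * (if x \<in> descendants k (\<omega> j) then 1 else 0) =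
            (if j = j0 then (real q powr s) ^ j0 * indicator (E (ancestor k x)) \<omega> else 0)"
          by (simp add: indicator_def)
      qed
      also have "\<dots> = (real q powr s) ^ j0 * indicator (E (ancestor k x)) \<omega>"
        using j0 by (subst sum.delta) auto
      finally have "real q powr (- s * k) *
          (\<Sum>j<Suc K. (real q powr s) ^ j * (if x \<in> descendants k (\<omega> j) then 1 else 0)) =
          (real q powr (- s * k) * (real q powr s) ^ j0) * indicator (E (ancestor k x)) \<omega>"
        by simp
      also have "real q powr (- s * k) * (real q powr s) ^ j0 = real q powr (s * (real (lev x) - 2 * real k))"
        using q by (simp add: j0 powr_powr algebra_simps flip: powr_realpow powr_add)
      finally show ?thesis
        using True by simp
    next
      case False
      then show ?thesis by (auto simp: mem intro!: sum.neutral)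
    qed
  qed
  finally show ?thesis by simp
qed

lemma nn_integral_level_sum_le:
  assumes "finite F"
  shows "(\<integral>\<^sup>+\<omega>. ennreal (level_sum 1 F k \<omega>) \<partial>\<nu>) \<le> ennreal (real q powr (- real k) * card F)"
proof -
  have q: "0 < real q"
    using q_ge_2 by simp
  let ?w = "\<lambda>x. real q powr (real (lev x) - 2 * real k)"
  have "(\<integral>\<^sup>+\<omega>. ennreal (level_sum 1 F k \<omega>) \<partial>\<nu>) =
      (\<Sum>x\<in>F. \<integral>\<^sup>+\<omega>. (if k \<le> lev x then ennreal (?w x) * indicator (E (ancestor k x)) \<omega> else 0) \<partial>\<nu>)"
    unfolding level_sum_def
    by (subst nn_integral_sum[symmetric])
      (auto intro!: nn_integral_cong sum.cong simp: indicator_def simp flip: sum_ennreal)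
  also have "\<dots> \<le> (\<Sum>x\<in>F. ennreal (real q powr (- real k)))"
  proof (rule sum_mono)
    fix x
    show "(\<integral>\<^sup>+\<omega>. (if k \<le> lev x then ennreal (?w x) * indicator (E (ancestor k x)) \<omega> else 0) \<partial>\<nu>) \<le>
        ennreal (real q powr (- real k))"
    proof (cases "k \<le> lev x")
      case True
      have "(\<integral>\<^sup>+\<omega>. (if k \<le> lev x then ennreal (?w x) * indicator (E (ancestor k x)) \<omega> else 0) \<partial>\<nu>) =
          ennreal (?w x) * emeasure \<nu> (E (ancestor k x))"
        using True by (simp add: nn_integral_cmult_indicator)
      also have "\<dots> \<le> ennreal (?w x) * ennreal (1 / real q ^ (lev x - k))"
        using emeasure_cylinder_le_power[of "ancestor k x"] True
        by (intro mult_left_mono) (auto simp: lev_ancestor)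
      also have "\<dots> = ennreal (?w x * (1 / real q ^ (lev x - k)))"
        by (simp flip: ennreal_mult)
      also have "?w x * (1 / real q ^ (lev x - k)) = real q powr (- real k)"
        using True q by (simp add: of_nat_diff flip: powr_realpow powr_diff)
      finally show ?thesis .
    qed simp
  qed
  also have "\<dots> = ennreal (real q powr (- real k) * card F)"
    by (simp add: ennreal_mult mult.commute ennreal_of_nat_eq_real_of_nat)
  finally show ?thesis .
qed

text \<open>The counts of descendants are bounded both by the growth of the tree and by the size of \<open>F\<close>.
  After \<open>lacunary_sum_powr_le\<close> the exponents are those of the kernel with \<open>s = 1\<close>, whose level sums
  have just been integrated.\<close>

lemma Lp_norm_level_sum_le:
  assumes F: "finite F" and \<rho>: "1 < \<rho>"
  defines "b \<equiv> real q powr (1 / \<rho>)"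
  shows "Lp_norm \<nu> (ennreal \<rho>) (\<lambda>\<omega>. of_real (level_sum (1 / \<rho>) F k \<omega>)) \<le>
    ennreal ((\<rho> * (b / (b - 1)) powr (\<rho> - 1)) powr (1 / \<rho>) *
      (real q powr (- (k / \<rho>)) * min (2 * real q ^ k) (card F) powr (1 - 1 / \<rho>) * card F powr (1 / \<rho>)))"
proof -
  have q: "1 < real q"
    using q_ge_2 by simp
  have b: "1 < b"
    unfolding b_def using q \<rho> by (intro gr_one_powr) auto
  define A where "A = min (2 * real q ^ k) (card F)"
  define D where "D = \<rho> * (b / (b - 1) * A) powr (\<rho> - 1)"
  have D: "0 \<le> D"
    unfolding D_def using \<rho> by simp
  obtain K where K: "\<And>x. x \<in> F \<Longrightarrow> lev x \<le> K"
    using lev_bounded[OF F] by blast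
  have pointwise: "level_sum (1 / \<rho>) F k \<omega> powr \<rho> \<le> D * level_sum 1 F k \<omega>" if \<omega>: "\<omega> \<in> Omega" for \<omega>
  proof -
    define a where "a = (\<lambda>j. real (card (F \<inter> descendants k (\<omega> j))))"
    have a: "a j \<le> A" for j
    proof -
      have "card (F \<inter> descendants k (\<omega> j)) \<le> card F"
        using F by (intro card_mono) auto
      moreover have "card (F \<inter> descendants k (\<omega> j)) \<le> 2 * q ^ k"
        using card_mono[OF finite_descendants, of "F \<inter> descendants k (\<omega> j)" k "\<omega> j"]
          card_descendants_le[of k "\<omega> j"] by simp
      then have "a j \<le> real (2 * q ^ k)"
        unfolding a_def by (rule of_nat_mono)
      ultimately show ?thesis
        by (simp add: A_def a_def)
    qed
    have eq: "level_sum s F k \<omega> = real q powr (- s * k) *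
        (\<Sum>j<Suc K. (real q powr s) ^ j * a j)" for s
      unfolding a_def using K by (intro level_sum_eq[OF \<omega> F])
    have "level_sum (1 / \<rho>) F k \<omega> powr \<rho> =
        (real q powr (- (1 / \<rho>) * k)) powr \<rho> * (\<Sum>j<Suc K. b ^ j * a j) powr \<rho>"
      unfolding eq b_def by (rule powr_mult)
    also have "\<dots> \<le> (real q powr (- (1 / \<rho>) * k)) powr \<rho> * (D * (\<Sum>j<Suc K. (b powr \<rho>) ^ j * a j))"
      unfolding D_def using b \<rho> a by (intro mult_left_mono lacunary_sum_powr_le) (auto simp: a_def)
    also have "\<dots> = D * level_sum 1 F k \<omega>"
      unfolding eq b_def using \<rho> q by (simp add: powr_powr del: sum.lessThan_Suc)
    finally show ?thesis .
  qed
  let ?c = "D powr (1 / \<rho>) * (real q powr (- real k) * card F) powr (1 / \<rho>)"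
  have "(\<integral>\<^sup>+\<omega>. ennreal (norm (complex_of_real (level_sum (1 / \<rho>) F k \<omega>)) powr \<rho>) \<partial>\<nu>) \<le>
      (\<integral>\<^sup>+\<omega>. ennreal D * ennreal (level_sum 1 F k \<omega>) \<partial>\<nu>)"
  proof (rule nn_integral_mono)
    fix \<omega> assume "\<omega> \<in> space \<nu>"
    then have "level_sum (1 / \<rho>) F k \<omega> powr \<rho> \<le> D * level_sum 1 F k \<omega>"
      by (intro pointwise) (simp add: space_nu)
    then show "ennreal (norm (complex_of_real (level_sum (1 / \<rho>) F k \<omega>)) powr \<rho>) \<le>
        ennreal D * ennreal (level_sum 1 F k \<omega>)"
      using D level_sum_nonneg by (simp add: ennreal_leI flip: ennreal_mult)
  qed
  also have "\<dots> = ennreal D * (\<integral>\<^sup>+\<omega>. ennreal (level_sum 1 F k \<omega>) \<partial>\<nu>)"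
    by (intro nn_integral_cmult) auto
  also have "\<dots> \<le> ennreal D * ennreal (real q powr (- real k) * card F)"
    by (intro mult_left_mono nn_integral_level_sum_le F) auto
  also have "\<dots> = ennreal (?c powr \<rho>)"
    using D \<rho> by (simp add: powr_mult powr_powr flip: ennreal_mult)
  finally have "Lp_norm \<nu> (ennreal \<rho>) (\<lambda>\<omega>. of_real (level_sum (1 / \<rho>) F k \<omega>)) \<le> ennreal ?c"
    using \<rho> by (intro Lp_norm_leI) auto
  also have "D powr (1 / \<rho>) = (\<rho> * (b / (b - 1)) powr (\<rho> - 1)) powr (1 / \<rho>) * A powr (1 - 1 / \<rho>)"
  proof -
    have "D = (\<rho> * (b / (b - 1)) powr (\<rho> - 1)) * A powr (\<rho> - 1)"
      unfolding D_def powr_mult by (simp only: mult.assoc)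
    then show ?thesis
      using \<rho> by (simp add: powr_mult powr_powr diff_divide_distrib)
  qed
  also have "(real q powr (- real k) * card F) powr (1 / \<rho>) = real q powr (- (k / \<rho>)) * card F powr (1 / \<rho>)"
    by (simp add: powr_mult powr_powr)
  finally show ?thesis
    by (simp add: A_def mult_ac)
qed

text \<open>Estimates of restricted type, that is, on characteristic functions. The number
  \<open>enn2real (inverse r)\<close> is \<open>1 / r\<close>, also for \<open>r = \<infinity>\<close>.\<close>

definition restricted_type :: "ennreal \<Rightarrow> real \<Rightarrow> real \<Rightarrow> bool" where
  "restricted_type r P C \<longleftrightarrow> (\<forall>F. finite F \<longrightarrow>
     Lp_norm \<nu> r (\<lambda>\<omega>. of_real (\<Sum>x\<in>F. kernel (enn2real (inverse r)) x \<omega>)) \<le>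
       ennreal (C * real (card F) powr (1 / P)))"

lemma restricted_type_1:
  assumes "1 \<le> r"
  shows "restricted_type r 1 1"
  unfolding restricted_type_def
proof (intro allI impI)
  fix F :: "'v set" assume F: "finite F"
  let ?k = "kernel (enn2real (inverse r))"
  have "Lp_norm \<nu> r (\<lambda>\<omega>. \<Sum>x\<in>F. complex_of_real (?k x \<omega>)) \<le>
      (\<Sum>x\<in>F. Lp_norm \<nu> r (\<lambda>\<omega>. complex_of_real (?k x \<omega>)))"
    using assms F by (intro Lp_norm_sum_le) auto
  also have "\<dots> \<le> (\<Sum>x\<in>F. 1)"
    by (intro sum_mono Lp_norm_kernel_le_1 assms)
  also have "\<dots> = ennreal (1 * real (card F) powr (1 / 1))"
    by (simp add: ennreal_of_nat_eq_real_of_nat)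
  finally show "Lp_norm \<nu> r (\<lambda>\<omega>. of_real (\<Sum>x\<in>F. ?k x \<omega>)) \<le> ennreal (1 * real (card F) powr (1 / 1))"
    by simp
qed

lemma restricted_type_of_level_series:
  assumes \<rho>: "1 < \<rho>" and C: "0 < C" and series: "\<And>m K. 1 \<le> m \<Longrightarrow>
    (\<Sum>k\<le>(K::nat). real q powr (- (k / \<rho>)) * min (2 * real q ^ k) m powr (1 - 1 / \<rho>) * m powr (1 / \<rho>)) \<le>
      C * m powr (1 / P)"
  shows "\<exists>C>0. restricted_type (ennreal \<rho>) P C"
proof -
  define b where "b = real q powr (1 / \<rho>)"
  have b: "1 < b"
    unfolding b_def using q_ge_2 \<rho> by (intro gr_one_powr) auto
  define D where "D = (\<rho> * (b / (b - 1)) powr (\<rho> - 1)) powr (1 / \<rho>)"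
  have D: "0 < D"
    unfolding D_def using b \<rho> by simp
  have s: "enn2real (inverse (ennreal \<rho>)) = 1 / \<rho>"
    using \<rho> by (simp add: inverse_ennreal divide_inverse)
  have r: "1 \<le> ennreal \<rho>"
    using \<rho> by simp
  have "restricted_type (ennreal \<rho>) P (D * C)"
    unfolding restricted_type_def s
  proof (intro allI impI)
    fix F :: "'v set" assume F: "finite F"
    show "Lp_norm \<nu> (ennreal \<rho>) (\<lambda>\<omega>. of_real (\<Sum>x\<in>F. kernel (1 / \<rho>) x \<omega>)) \<le>
        ennreal (D * C * real (card F) powr (1 / P))"
    proof (cases "F = {}")
      case True
      then show ?thesis
        using Lp_norm_zero[OF r, of \<nu>] by simp
    next
      case False
      define m where "m = real (card F)"
      have m: "1 \<le> m"
        using F False by (simp add: m_def card_gt_0_iff Suc_le_eq)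
      obtain K where K: "\<And>x. x \<in> F \<Longrightarrow> lev x \<le> K"
        using lev_bounded[OF F] by blast
      let ?t = "\<lambda>k::nat. real q powr (- (k / \<rho>)) * min (2 * real q ^ k) m powr (1 - 1 / \<rho>) * m powr (1 / \<rho>)"
      have "Lp_norm \<nu> (ennreal \<rho>) (\<lambda>\<omega>. of_real (\<Sum>x\<in>F. kernel (1 / \<rho>) x \<omega>)) \<le>
          Lp_norm \<nu> (ennreal \<rho>) (\<lambda>\<omega>. \<Sum>k\<le>K. complex_of_real (level_sum (1 / \<rho>) F k \<omega>))"
      proof (intro Lp_norm_AE_mono r AE_I2)
        fix \<omega> assume "\<omega> \<in> space \<nu>"
        then have "(\<Sum>x\<in>F. kernel (1 / \<rho>) x \<omega>) \<le> (\<Sum>k\<le>K. level_sum (1 / \<rho>) F k \<omega>)"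
          using K by (intro kernel_sum_le_level_sums) (auto simp: space_nu)
        moreover have "0 \<le> (\<Sum>x\<in>F. kernel (1 / \<rho>) x \<omega>)"
          by (intro sum_nonneg kernel_nonneg)
        ultimately show "norm (complex_of_real (\<Sum>x\<in>F. kernel (1 / \<rho>) x \<omega>)) \<le>
            norm (\<Sum>k\<le>K. complex_of_real (level_sum (1 / \<rho>) F k \<omega>))"
          by (simp flip: of_real_sum)
      qed auto
      also have "\<dots> \<le> (\<Sum>k\<le>K. Lp_norm \<nu> (ennreal \<rho>) (\<lambda>\<omega>. complex_of_real (level_sum (1 / \<rho>) F k \<omega>)))"
        by (intro Lp_norm_sum_le r) auto
      also have "\<dots> \<le> (\<Sum>k\<le>K. ennreal (D * ?t k))"
        using Lp_norm_level_sum_le[OF F \<rho>] by (intro sum_mono) (simp add: D_def b_def m_def)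
      also have "\<dots> = ennreal (D * (\<Sum>k\<le>K. ?t k))"
        using D by (subst sum_ennreal) (auto simp: sum_distrib_left)
      also have "\<dots> \<le> ennreal (D * (C * m powr (1 / P)))"
        using D series[OF m] by (intro ennreal_leI mult_left_mono) auto
      finally show ?thesis
        by (simp add: m_def mult.assoc)
    qed
  qed
  then show ?thesis
    using C D by (intro exI[of _ "D * C"]) auto
qed

lemma restricted_type_interior:
  assumes "1 < \<rho>" "1 \<le> P" "P \<le> \<rho>" "1 - 1 / P < 1 / \<rho>"
  shows "\<exists>C>0. restricted_type (ennreal \<rho>) P C"
proof -
  obtain C where "C > 0" "\<And>m K. 1 \<le> m \<Longrightarrow>
    (\<Sum>k\<le>(K::nat). real q powr (- (k / \<rho>)) * min (2 * real q ^ k) m powr (1 - 1 / \<rho>) * m powr (1 / \<rho>)) \<le>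
      C * m powr (1 - (1 - 1 / P))"
    using level_series_interior[of "real q" \<rho> "1 - 1 / P"] assms q_ge_2 by (auto simp: field_simps)
  then show ?thesis
    using assms by (intro restricted_type_of_level_series) auto
qed

lemma restricted_type_endpoint:
  assumes "2 < \<rho>" "1 / P = 1 - 1 / \<rho>"
  shows "\<exists>C>0. restricted_type (ennreal \<rho>) P C"
proof -
  obtain C where "C > 0" "\<And>m K. 1 \<le> m \<Longrightarrow>
    (\<Sum>k\<le>(K::nat). real q powr (- (k / \<rho>)) * min (2 * real q ^ k) m powr (1 - 1 / \<rho>) * m powr (1 / \<rho>)) \<le>
      C * m powr (1 - 1 / \<rho>)"
    using level_series_endpoint[of "real q" \<rho>] assms q_ge_2 by auto
  then show ?thesis
    using assms by (intro restricted_type_of_level_series) auto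
qed

end

context rooted_tree
begin

section \<open>From characteristic functions to the extension\<close>

text \<open>A finitely supported function is dominated by twice the sum of the functions
  equal to \<open>2\<^sup>j\<close> on \<open>{|f| > 2\<^sup>j}\<close> and to 0 elsewhere, where \<open>j\<close> runs over the integers with
  \<open>2\<^sup>j < |f x| \<le> 2\<^sup>j\<^sup>+\<^sup>1\<close> for some \<open>x\<close>.\<close>

lemma dyadic_bound:
  fixes f :: "'v \<Rightarrow> complex"
  assumes r: "1 \<le> r" and f: "finitely_supported f" and C: "0 \<le> C" "restricted_type r P C"
  obtains J :: "int set" where "finite J" "\<And>j. j \<in> J \<Longrightarrow> finite {x. norm (f x) > 2 powr j}"
    "\<And>j. j \<in> J \<Longrightarrow> {x. norm (f x) > 2 powr j} \<noteq> {}"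
    "Lp_norm \<nu> r (\<lambda>\<omega>. of_real (\<Sum>x | f x \<noteq> 0. norm (f x) * kernel (enn2real (inverse r)) x \<omega>)) \<le>
      ennreal (2 * C) *
      ennreal (\<Sum>j\<in>J. 2 powr j * real (card {x. norm (f x) > 2 powr j}) powr (1 / P))"
proof -
  define S where "S = {x. f x \<noteq> 0}"
  have S: "finite S"
    using f by (simp add: S_def finitely_supported_def)
  define level where "level = (\<lambda>x. \<lceil>log 2 (norm (f x))\<rceil> - 1)"
  have level: "2 powr level x < norm (f x)" "norm (f x) \<le> 2 * 2 powr level x" if "x \<in> S" for x
  proof -
    have pos: "0 < norm (f x)"
      using that by (simp add: S_def)
    have "real_of_int (level x) < log 2 (norm (f x))" "log 2 (norm (f x)) \<le> 1 + real_of_int (level x)"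
      unfolding level_def by linarith+
    then show "2 powr level x < norm (f x)" "norm (f x) \<le> 2 * 2 powr level x"
      using pos by (simp_all add: less_log_iff log_le_iff powr_add)
  qed
  define J where "J = level ` S"
  define F where "F = (\<lambda>j::int. {x. norm (f x) > 2 powr j})"
  have F_subset: "F j \<subseteq> S" for j
    unfolding F_def S_def using powr_gt_zero[of 2 "real_of_int j"] by auto
  then have F: "finite (F j)" for j
    using S finite_subset by blast
  define k where "k = kernel (enn2real (inverse r))"
  have k: "0 \<le> k x \<omega>" for x \<omega>
    by (simp add: k_def kernel_nonneg)
  have [measurable]: "k x \<in> borel_measurable \<nu>" for x
    by (simp add: k_def)
  have pointwise: "(\<Sum>x\<in>S. norm (f x) * k x \<omega>) \<le> (\<Sum>j\<in>J. 2 * 2 powr j * (\<Sum>x\<in>F j. k x \<omega>))" for \<omega>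
  proof -
    have "(\<Sum>x\<in>S. norm (f x) * k x \<omega>) \<le> (\<Sum>x\<in>S. \<Sum>j\<in>J. if x \<in> F j then 2 * 2 powr j * k x \<omega> else 0)"
    proof (rule sum_mono)
      fix x assume x: "x \<in> S"
      have "norm (f x) * k x \<omega> \<le> (if x \<in> F (level x) then 2 * 2 powr level x * k x \<omega> else 0)"
        using level[OF x] k by (simp add: F_def mult_right_mono)
      also have "\<dots> \<le> (\<Sum>j\<in>J. if x \<in> F j then 2 * 2 powr j * k x \<omega> else 0)"
        using x S k by (intro member_le_sum) (auto simp: J_def)
      finally show "norm (f x) * k x \<omega> \<le> (\<Sum>j\<in>J. if x \<in> F j then 2 * 2 powr j * k x \<omega> else 0)" .
    qed
    also have "\<dots> = (\<Sum>j\<in>J. \<Sum>x\<in>S. if x \<in> F j then 2 * 2 powr j * k x \<omega> else 0)"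
      by (rule sum.swap)
    also have "\<dots> = (\<Sum>j\<in>J. 2 * 2 powr j * (\<Sum>x\<in>F j. k x \<omega>))"
    proof (rule sum.cong[OF refl])
      fix j
      have "(\<Sum>x\<in>S. if x \<in> F j then 2 * 2 powr j * k x \<omega> else 0) = (\<Sum>x\<in>F j. 2 * 2 powr j * k x \<omega>)"
        using F_subset[of j] S by (intro sum.mono_neutral_cong_right) auto
      then show "(\<Sum>x\<in>S. if x \<in> F j then 2 * 2 powr j * k x \<omega> else 0) = 2 * 2 powr j * (\<Sum>x\<in>F j. k x \<omega>)"
        by (simp add: sum_distrib_left)
    qed
    finally show ?thesis .
  qed
  have "Lp_norm \<nu> r (\<lambda>\<omega>. of_real (\<Sum>x\<in>S. norm (f x) * k x \<omega>)) \<le>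
      Lp_norm \<nu> r (\<lambda>\<omega>. \<Sum>j\<in>J. complex_of_real (2 * 2 powr j) * of_real (\<Sum>x\<in>F j. k x \<omega>))"
  proof (intro Lp_norm_AE_mono r AE_I2)
    fix \<omega>
    have "(\<Sum>j\<in>J. complex_of_real (2 * 2 powr j) * of_real (\<Sum>x\<in>F j. k x \<omega>)) =
        of_real (\<Sum>j\<in>J. 2 * 2 powr j * (\<Sum>x\<in>F j. k x \<omega>))"
      by simp
    moreover have "0 \<le> (\<Sum>x\<in>S. norm (f x) * k x \<omega>)"
      using k by (intro sum_nonneg) auto
    ultimately show "norm (complex_of_real (\<Sum>x\<in>S. norm (f x) * k x \<omega>)) \<le>
        norm (\<Sum>j\<in>J. complex_of_real (2 * 2 powr j) * of_real (\<Sum>x\<in>F j. k x \<omega>))"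
      using pointwise[of \<omega>] by (simp only: norm_of_real)
  qed auto
  also have "\<dots> \<le> (\<Sum>j\<in>J. Lp_norm \<nu> r (\<lambda>\<omega>. complex_of_real (2 * 2 powr j) * of_real (\<Sum>x\<in>F j. k x \<omega>)))"
    using S by (intro Lp_norm_sum_le r) (auto simp: J_def)
  also have "\<dots> \<le> (\<Sum>j\<in>J. ennreal (2 * 2 powr j) * ennreal (C * real (card (F j)) powr (1 / P)))"
  proof (rule sum_mono)
    fix j
    have "Lp_norm \<nu> r (\<lambda>\<omega>. complex_of_real (2 * 2 powr j) * of_real (\<Sum>x\<in>F j. k x \<omega>)) \<le>
        ennreal (norm (complex_of_real (2 * 2 powr j))) * Lp_norm \<nu> r (\<lambda>\<omega>. of_real (\<Sum>x\<in>F j. k x \<omega>))"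
      by (intro Lp_norm_cmult_le r) measurable
    also have "\<dots> \<le> ennreal (2 * 2 powr j) * ennreal (C * real (card (F j)) powr (1 / P))"
      using C(2) F[of j] by (intro mult_mono) (auto simp: restricted_type_def k_def norm_mult)
    finally show "Lp_norm \<nu> r (\<lambda>\<omega>. complex_of_real (2 * 2 powr j) * of_real (\<Sum>x\<in>F j. k x \<omega>)) \<le>
        ennreal (2 * 2 powr j) * ennreal (C * real (card (F j)) powr (1 / P))" .
  qed
  also have "\<dots> = (\<Sum>j\<in>J. ennreal (2 * C * (2 powr j * real (card (F j)) powr (1 / P))))"
    using C by (intro sum.cong) (auto simp: mult_ac simp flip: ennreal_mult)
  also have "\<dots> = ennreal (2 * C) * ennreal (\<Sum>j\<in>J. 2 powr j * real (card (F j)) powr (1 / P))"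
    using C by (simp add: sum_nonneg sum_distrib_left flip: ennreal_mult)
  finally have main: "Lp_norm \<nu> r (\<lambda>\<omega>. of_real (\<Sum>x\<in>S. norm (f x) * k x \<omega>)) \<le>
      ennreal (2 * C) * ennreal (\<Sum>j\<in>J. 2 powr j * real (card (F j)) powr (1 / P))" .
  show ?thesis
  proof (rule that[of J])
    show "finite J"
      using S by (simp add: J_def)
    show "finite {x. norm (f x) > 2 powr j}" for j :: int
      using F[of j] by (simp add: F_def)
    show "{x. norm (f x) > 2 powr j} \<noteq> {}" if "j \<in> J" for j :: int
      using that level by (auto simp: J_def)
  qed (use main in \<open>simp add: S_def F_def k_def\<close>)
qed

text \<open>The role of the line for \<open>z\<close>: by \<open>1 / r + 1 / r' = 1\<close>, the absolute value of the kernel depends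
  on \<open>z\<close> only through \<open>r\<close>, so the constants are uniform in \<open>z\<close>.\<close>

lemma exponent_line:
  assumes "1 \<le> r" "Im z = delta (conj_exponent r)"
  shows "Re (1 / 2 + \<i> * z) = enn2real (inverse r)"
proof -
  have sum: "inverse r + inverse (conj_exponent r) = 1"
    by (rule conj_exponent[OF assms(1)])
  then have "inverse r < top" "inverse (conj_exponent r) < top"
    by (metis ennreal_add_eq_top ennreal_one_neq_top less_top)+
  then have "enn2real (inverse r) + enn2real (inverse (conj_exponent r)) = enn2real 1"
    by (simp add: sum flip: enn2real_plus)
  then show ?thesis
    using assms(2) by (simp add: delta_def)
qed

text \<open>All parts of the theorem follow from a bound for finitely supported functions that controls the
  sum of absolute values. By monotone convergence the series defining the transform then converges
  absolutely at almost every boundary point for every function of finite norm, so its sum is linear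
  up to null sets and bounded, which gives an extension; and any extension inherits the bound
  because truncation to balls approximates in the norm.\<close>

lemma extension_of_positive_bound:
  fixes N :: "('v \<Rightarrow> complex) \<Rightarrow> ennreal" and C :: real
  assumes r: "1 \<le> r" and z: "Im z = delta (conj_exponent r)" and C: "0 < C"
    and S: "S = {f. N f < \<infinity>}"
    and mono: "\<And>f g. (\<And>x. norm (f x) \<le> norm (g x)) \<Longrightarrow> N f \<le> N g"
    and tail: "\<And>f. N f < \<infinity> \<Longrightarrow> (\<lambda>n. N (\<lambda>x. if x \<in> {x. lev x \<le> n} then 0 else f x)) \<longlonglongrightarrow> 0"
    and bound: "\<And>f. finitely_supported f \<Longrightarrow>
      Lp_norm \<nu> r (\<lambda>\<omega>. of_real (\<Sum>x | f x \<noteq> 0. norm (f x) * kernel (enn2real (inverse r)) x \<omega>)) \<le>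
        ennreal C * N f"
  shows "(\<exists>T. helgason_fourier_extension q adj v0 z S N r T) \<and>
    (\<forall>T. helgason_fourier_extension q adj v0 z S N r T \<longrightarrow>
      (\<forall>f\<in>S. Lp_norm \<nu> r (T f) \<le> ennreal C * N f))"
proof -
  define k where "k = kernel (enn2real (inverse r))"
  have k: "0 \<le> k x \<omega>" for x \<omega>
    by (simp add: k_def kernel_nonneg)
  have [measurable]: "k x \<in> borel_measurable \<nu>" for x
    by (simp add: k_def)
  define p where "p = poisson_power q adj v0 (1 / 2 + \<i> * z)"
  have norm_p: "norm (p x \<omega>) = k x \<omega>" for x \<omega>
    by (simp only: p_def k_def norm_poisson_power exponent_line[OF r z])
  have [measurable]: "p x \<in> borel_measurable \<nu>" for x
    by (simp add: p_def)
  define trunc where "trunc = (\<lambda>n (f :: 'v \<Rightarrow> complex) x. if lev x \<le> n then f x else 0)"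
  have trunc_fin: "finitely_supported (trunc n f)" for n f
    unfolding finitely_supported_def by (rule finite_subset[OF _ finite_ball[of n]]) (auto simp: trunc_def)
  have trunc_le: "N (trunc n f) \<le> N f" for n f
    by (intro mono) (simp add: trunc_def)
  define maj where "maj = (\<lambda>(f :: 'v \<Rightarrow> complex) n \<omega>. \<Sum>x | lev x \<le> n. norm (f x) * k x \<omega>)"
  have [measurable]: "maj f n \<in> borel_measurable \<nu>" for f n
    unfolding maj_def by measurable
  have maj_nonneg: "0 \<le> maj f n \<omega>" for f n \<omega>
    unfolding maj_def using k by (intro sum_nonneg) auto
  have maj_inc: "maj f m \<omega> \<le> maj f n \<omega>" if "m \<le> n" for f m n \<omega>
    unfolding maj_def using k that finite_ball by (intro sum_mono2) auto
  have maj_bound: "Lp_norm \<nu> r (\<lambda>\<omega>. of_real (maj f n \<omega>)) \<le> ennreal C * N f" for f n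
  proof -
    have "maj f n \<omega> = (\<Sum>x | trunc n f x \<noteq> 0. norm (trunc n f x) * k x \<omega>)" for \<omega>
      unfolding maj_def using finite_ball[of n]
      by (intro sum.mono_neutral_cong_right) (auto simp: trunc_def)
    then have "Lp_norm \<nu> r (\<lambda>\<omega>. of_real (maj f n \<omega>)) \<le> ennreal C * N (trunc n f)"
      using bound[OF trunc_fin[of n f]] by (simp add: k_def)
    also have "\<dots> \<le> ennreal C * N f"
      by (intro mult_left_mono trunc_le) auto
    finally show ?thesis .
  qed
  have maj_SUP: "(SUP n. ennreal (maj f n \<omega>)) = (\<integral>\<^sup>+x. ennreal (norm (f x * p x \<omega>)) \<partial>count_space UNIV)" for f \<omega>
  proof -
    let ?u = "\<lambda>n x. ennreal (norm (f x) * k x \<omega>) * indicator {x. lev x \<le> n} x"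
    have "(\<integral>\<^sup>+x. (SUP n. ?u n x) \<partial>count_space UNIV) = (SUP n. \<integral>\<^sup>+x. ?u n x \<partial>count_space UNIV)"
      by (intro nn_integral_monotone_convergence_SUP incseq_SucI le_funI) (auto simp: indicator_def)
    moreover have "(SUP n. ?u n x) = ennreal (norm (f x * p x \<omega>))" for x
    proof (rule antisym)
      show "(SUP n. ?u n x) \<le> ennreal (norm (f x * p x \<omega>))"
        by (intro SUP_least) (auto simp: indicator_def norm_mult norm_p)
      show "ennreal (norm (f x * p x \<omega>)) \<le> (SUP n. ?u n x)"
        by (rule SUP_upper2[of "lev x"]) (auto simp: norm_mult norm_p)
    qed
    moreover have "(\<integral>\<^sup>+x. ?u n x \<partial>count_space UNIV) = ennreal (maj f n \<omega>)" for n
    proof -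
      have "(\<integral>\<^sup>+x. ?u n x \<partial>count_space UNIV) = (\<Sum>x | lev x \<le> n. ?u n x)"
        using finite_ball[of n] by (intro nn_integral_count_space') auto
      also have "\<dots> = ennreal (maj f n \<omega>)"
        unfolding maj_def using k by (subst sum_ennreal[symmetric]) auto
      finally show ?thesis .
    qed
    ultimately show ?thesis by simp
  qed
  \<comment> \<open>the integral is 0 at the boundary points where the series does not converge absolutely\<close>
  define H where "H = (\<lambda>(f :: 'v \<Rightarrow> complex) \<omega>. \<integral>x. f x * p x \<omega> \<partial>count_space UNIV)"
  have [measurable]: "H f \<in> borel_measurable \<nu>" for f
  proof -
    interpret sigma_finite_measure "count_space (UNIV :: 'v set)"
      by (intro sigma_finite_measure_count_space_countable countable_vertices)
    have "(\<lambda>(x, \<omega>). f x * p x \<omega>) \<in> borel_measurable (count_space UNIV \<Otimes>\<^sub>M \<nu>)"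
      by (intro measurable_pair_measure_countable1 countable_vertices) simp
    then have "(\<lambda>(\<omega>, x). f x * p x \<omega>) \<in> borel_measurable (\<nu> \<Otimes>\<^sub>M count_space UNIV)"
      using measurable_pair_swap by fastforce
    then show ?thesis
      unfolding H_def by (rule borel_measurable_lebesgue_integral)
  qed
  have integrable: "AE \<omega> in \<nu>. integrable (count_space UNIV) (\<lambda>x. f x * p x \<omega>)"
    and H_bound: "Lp_norm \<nu> r (H f) \<le> ennreal C * N f" if f: "N f < \<infinity>" for f
  proof -
    obtain a where a: "N f = ennreal a" "0 \<le> a"
      using f by (cases "N f") auto
    have b: "Lp_norm \<nu> r (\<lambda>\<omega>. of_real (maj f n \<omega>)) \<le> ennreal (C * a)" for n
      using maj_bound[of f n] a C by (simp add: ennreal_mult)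
    have "0 \<le> C * a"
      using a C by simp
    note lim = Lp_norm_monotone_limit[of r "maj f", OF r _ maj_nonneg maj_inc this b]
    have fin: "AE \<omega> in \<nu>. (SUP n. ennreal (maj f n \<omega>)) < \<infinity>"
      by (rule lim(1)) auto
    then show "AE \<omega> in \<nu>. integrable (count_space UNIV) (\<lambda>x. f x * p x \<omega>)"
      by eventually_elim (auto intro!: integrableI_bounded simp: maj_SUP)
    have "Lp_norm \<nu> r (H f) \<le> ennreal (C * a)"
    proof (rule lim(2))
      show "AE \<omega> in \<nu>. ennreal (norm (H f \<omega>)) \<le> (SUP n. ennreal (maj f n \<omega>))"
      proof (rule AE_I2)
        fix \<omega>
        show "ennreal (norm (H f \<omega>)) \<le> (SUP n. ennreal (maj f n \<omega>))"
        proof (cases "integrable (count_space UNIV) (\<lambda>x. f x * p x \<omega>)")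
          case True
          then show ?thesis
            unfolding H_def maj_SUP by (rule integral_norm_bound_ennreal)
        qed (simp add: H_def not_integrable_integral_eq)
      qed
    qed auto
    then show "Lp_norm \<nu> r (H f) \<le> ennreal C * N f"
      using a C by (simp add: ennreal_mult)
  qed
  have H_finite: "H f \<omega> = helgason_fourier q adj v0 f z \<omega>" if f: "finitely_supported f" for f \<omega>
  proof -
    have fin: "finite {x. f x \<noteq> 0}"
      using f by (simp add: finitely_supported_def)
    have "H f \<omega> = (\<Sum>x | f x * p x \<omega> \<noteq> 0. f x * p x \<omega>)"
      unfolding H_def using fin
      by (subst lebesgue_integral_count_space_finite_support) (auto intro: finite_subset[rotated])
    also have "\<dots> = (\<Sum>x | f x \<noteq> 0. f x * p x \<omega>)"
      using fin by (intro sum.mono_neutral_left) auto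
    finally show ?thesis
      by (simp add: helgason_fourier_def p_def)
  qed
  have "helgason_fourier_extension q adj v0 z S N r H"
    unfolding helgason_fourier_extension_def Let_def
  proof (intro conjI ballI allI impI)
    fix f assume "f \<in> S"
    then have f: "N f < \<infinity>" by (simp add: S)
    have "ennreal C * N f < \<infinity>"
      using f by (simp add: ennreal_mult_less_top)
    then show "H f \<in> Lp_space \<nu> r"
      using H_bound[OF f] by (auto simp: Lp_space_def intro: le_less_trans)
  next
    fix f assume "f \<in> S" "finitely_supported f"
    then show "AE \<omega> in \<nu>. H f \<omega> = helgason_fourier q adj v0 f z \<omega>"
      by (simp add: H_finite)
  next
    fix f \<phi> assume f: "f \<in> S" and \<phi>: "(\<forall>n. \<phi> n \<in> S) \<and> (\<lambda>n. N (\<lambda>x. \<phi> n x - f x)) \<longlonglongrightarrow> 0"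
    have le: "Lp_norm \<nu> r (\<lambda>\<omega>. H (\<phi> n) \<omega> - H f \<omega>) \<le> ennreal C * N (\<lambda>x. \<phi> n x - f x)" for n
    proof (cases "N (\<lambda>x. \<phi> n x - f x) < \<infinity>")
      case True
      have "N (\<phi> n) < \<infinity>" "N f < \<infinity>"
        using f \<phi> by (auto simp: S)
      then have "AE \<omega> in \<nu>. H (\<phi> n) \<omega> - H f \<omega> = H (\<lambda>x. \<phi> n x - f x) \<omega>"
        using integrable[of "\<phi> n"] integrable[of f]
        unfolding H_def left_diff_distrib by (auto elim: eventually_elim2)
      then have "Lp_norm \<nu> r (\<lambda>\<omega>. H (\<phi> n) \<omega> - H f \<omega>) \<le> Lp_norm \<nu> r (H (\<lambda>x. \<phi> n x - f x))"
        by (intro Lp_norm_AE_mono r) (auto elim: eventually_mono)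
      also note H_bound[OF True]
      finally show ?thesis .
    next
      case False
      then show ?thesis
        using C by (simp add: not_less top_unique ennreal_mult_top)
    qed
    have "(\<lambda>n. ennreal C * N (\<lambda>x. \<phi> n x - f x)) \<longlonglongrightarrow> ennreal C * 0"
      using \<phi> by (intro ennreal_tendsto_cmult) auto
    then have lim: "(\<lambda>n. ennreal C * N (\<lambda>x. \<phi> n x - f x)) \<longlonglongrightarrow> 0"
      by simp
     show "(\<lambda>n. Lp_norm \<nu> r (\<lambda>\<omega>. H (\<phi> n) \<omega> - H f \<omega>)) \<longlonglongrightarrow> 0"
      by (rule tendsto_sandwich[OF _ _ tendsto_const lim]) (simp_all add: le)
  qed
  moreover have "Lp_norm \<nu> r (T f) \<le> ennreal C * N f"
    if T: "helgason_fourier_extension q adj v0 z S N r T" and "f \<in> S" for T f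
  proof -
    have f: "N f < \<infinity>"
      using \<open>f \<in> S\<close> by (simp add: S)
    have trunc_S: "trunc n f \<in> S" for n
      using trunc_le[of n f] f by (auto simp: S intro: le_less_trans)
    have [measurable]: "T g \<in> borel_measurable \<nu>" if "g \<in> S" for g
      using T that by (auto simp: helgason_fourier_extension_def Lp_space_def Let_def)
    have [measurable]: "T f \<in> borel_measurable \<nu>" "T (trunc n f) \<in> borel_measurable \<nu>" for n
      using \<open>f \<in> S\<close> trunc_S by auto
    have "N (\<lambda>x. trunc n f x - f x) = N (\<lambda>x. if x \<in> {x. lev x \<le> n} then 0 else f x)" for n
      by (intro antisym mono) (auto simp: trunc_def)
    then have "(\<lambda>n. N (\<lambda>x. trunc n f x - f x)) \<longlonglongrightarrow> 0"
      using tail[OF f] by simp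
    moreover have "\<forall>\<phi>. (\<forall>n. \<phi> n \<in> S) \<and> (\<lambda>n. N (\<lambda>x. \<phi> n x - f x)) \<longlonglongrightarrow> 0 \<longrightarrow>
        (\<lambda>n. Lp_norm \<nu> r (\<lambda>\<omega>. T (\<phi> n) \<omega> - T f \<omega>)) \<longlonglongrightarrow> 0"
      using T \<open>f \<in> S\<close> by (simp add: helgason_fourier_extension_def Let_def)
    ultimately have lim: "(\<lambda>n. Lp_norm \<nu> r (\<lambda>\<omega>. T (trunc n f) \<omega> - T f \<omega>)) \<longlonglongrightarrow> 0"
      using trunc_S by (auto dest: spec[of _ "\<lambda>n. trunc n f"])
    have "Lp_norm \<nu> r (T f) \<le> ennreal C * N f + Lp_norm \<nu> r (\<lambda>\<omega>. T (trunc n f) \<omega> - T f \<omega>)" for n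
    proof -
      have "AE \<omega> in \<nu>. T (trunc n f) \<omega> = helgason_fourier q adj v0 (trunc n f) z \<omega>"
        using T trunc_S trunc_fin by (auto simp: helgason_fourier_extension_def Let_def)
      then have "AE \<omega> in \<nu>. T (trunc n f) \<omega> = H (trunc n f) \<omega>"
        by (simp add: H_finite[OF trunc_fin])
      then have "Lp_norm \<nu> r (T (trunc n f)) \<le> Lp_norm \<nu> r (H (trunc n f))"
        by (intro Lp_norm_AE_mono r) (auto elim: eventually_mono)
      also have "\<dots> \<le> ennreal C * N (trunc n f)"
        using trunc_S by (intro H_bound) (auto simp: S)
      also have "\<dots> \<le> ennreal C * N f"
        by (intro mult_left_mono trunc_le) auto
      finally have 1: "Lp_norm \<nu> r (T (trunc n f)) \<le> ennreal C * N f" .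
      have "Lp_norm \<nu> r (\<lambda>\<omega>. T (trunc n f) \<omega> + (T f \<omega> - T (trunc n f) \<omega>)) \<le>
          Lp_norm \<nu> r (T (trunc n f)) + Lp_norm \<nu> r (\<lambda>\<omega>. T f \<omega> - T (trunc n f) \<omega>)"
        by (intro Lp_norm_triangle r) auto
      also have "Lp_norm \<nu> r (\<lambda>\<omega>. T f \<omega> - T (trunc n f) \<omega>) \<le> Lp_norm \<nu> r (\<lambda>\<omega>. T (trunc n f) \<omega> - T f \<omega>)"
        by (intro Lp_norm_AE_mono r AE_I2) (auto simp: norm_minus_commute)
      finally show ?thesis
        using 1 by (simp add: add_left_mono) (meson add_right_mono order_trans)
    qed
    moreover have "(\<lambda>n. ennreal C * N f + Lp_norm \<nu> r (\<lambda>\<omega>. T (trunc n f) \<omega> - T f \<omega>)) \<longlonglongrightarrow> ennreal C * N f + 0"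
      by (intro tendsto_add tendsto_const lim)
    ultimately show ?thesis
      using LIMSEQ_le_const[of _ "ennreal C * N f + 0" "Lp_norm \<nu> r (T f)"] by auto
  qed
  ultimately show ?thesis by blast
qed

lemma eventually_in_ball: "eventually (\<lambda>n. x \<in> {x. lev x \<le> n}) sequentially"
  using eventually_ge_at_top[of "lev x"] by simp

lemma Lp_space_count_space: "Lp_space (count_space UNIV) r = {f. Lp_norm (count_space UNIV) r f < \<infinity>}"
  by (auto simp: Lp_space_def)

lemma Lp_norm_count_space_mono:
  assumes "1 \<le> r" "\<And>x. norm (f x) \<le> norm (g x)"
  shows "Lp_norm (count_space UNIV) r f \<le> Lp_norm (count_space UNIV) r g"
  using assms by (intro Lp_norm_AE_mono) auto

lemma extension_lorentz:
  assumes r: "1 \<le> r" and z: "Im z = delta (conj_exponent r)" and p: "1 \<le> p"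
    and C: "0 < C" "restricted_type r p C"
  shows "(\<exists>T. helgason_fourier_extension q adj v0 z (lorentz_space p) (lorentz_norm p) r T) \<and>
    (\<forall>T. helgason_fourier_extension q adj v0 z (lorentz_space p) (lorentz_norm p) r T \<longrightarrow>
      (\<forall>f\<in>lorentz_space p. Lp_norm \<nu> r (T f) \<le> ennreal (4 * C) * lorentz_norm p f))"
proof (rule extension_of_positive_bound[OF r z])
  fix f :: "'v \<Rightarrow> complex" assume f: "finitely_supported f"
  obtain J :: "int set" where J: "finite J" "\<And>j. j \<in> J \<Longrightarrow> finite {x. norm (f x) > 2 powr j}"
    "\<And>j. j \<in> J \<Longrightarrow> {x. norm (f x) > 2 powr j} \<noteq> {}"
    "Lp_norm \<nu> r (\<lambda>\<omega>. of_real (\<Sum>x | f x \<noteq> 0. norm (f x) * kernel (enn2real (inverse r)) x \<omega>)) \<le>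
      ennreal (2 * C) *
      ennreal (\<Sum>j\<in>J. 2 powr j * real (card {x. norm (f x) > 2 powr j}) powr (1 / p))"
    using dyadic_bound[OF r f less_imp_le[OF C(1)] C(2)] by blast
  note J(4)
  also have "ennreal (2 * C) * ennreal (\<Sum>j\<in>J. 2 powr j * real (card {x. norm (f x) > 2 powr j}) powr (1 / p)) \<le>
      ennreal (2 * C) * (2 * lorentz_norm p f)"
    using p J by (intro mult_left_mono dyadic_le_lorentz_norm) auto
  also have "\<dots> = ennreal (4 * C) * lorentz_norm p f"
  proof -
    have "ennreal (4 * C) = ennreal (2 * C) * 2"
      using C by (simp flip: ennreal_numeral ennreal_mult)
    then show ?thesis by (simp add: mult.assoc)
  qed
  finally show "Lp_norm \<nu> r (\<lambda>\<omega>. of_real (\<Sum>x | f x \<noteq> 0. norm (f x) * kernel (enn2real (inverse r)) x \<omega>)) \<le>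
      ennreal (4 * C) * lorentz_norm p f" .
qed (use p C eventually_in_ball in \<open>auto simp: lorentz_space_def intro!: lorentz_norm_mono
      lorentz_norm_tail_tendsto_0[where B = "\<lambda>n. {x. lev x \<le> n}", simplified]\<close>)

lemma extension_Lp:
  assumes r: "1 \<le> r" and z: "Im z = delta (conj_exponent r)" and p: "1 \<le> p" "p < P"
    and C: "0 < C" "restricted_type r P C"
  defines "b \<equiv> 2 powr (1 - p / P)"
  defines "N \<equiv> Lp_norm (count_space UNIV :: 'v measure) (ennreal p)"
  shows "(\<exists>T. helgason_fourier_extension q adj v0 z (Lp_space (count_space UNIV) (ennreal p)) N r T) \<and>
    (\<forall>T. helgason_fourier_extension q adj v0 z (Lp_space (count_space UNIV) (ennreal p)) N r T \<longrightarrow>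
      (\<forall>f\<in>Lp_space (count_space UNIV) (ennreal p).
        Lp_norm \<nu> r (T f) \<le> ennreal (2 * C * (b / (b - 1))) * N f))"
proof (rule extension_of_positive_bound[OF r z])
  have b: "1 < b"
    unfolding b_def using p by (simp add: field_simps)
  then show "0 < 2 * C * (b / (b - 1))"
    using C by simp
  fix f :: "'v \<Rightarrow> complex" assume f: "finitely_supported f"
  obtain J :: "int set" where J: "finite J" "\<And>j. j \<in> J \<Longrightarrow> finite {x. norm (f x) > 2 powr j}"
    "\<And>j. j \<in> J \<Longrightarrow> {x. norm (f x) > 2 powr j} \<noteq> {}"
    "Lp_norm \<nu> r (\<lambda>\<omega>. of_real (\<Sum>x | f x \<noteq> 0. norm (f x) * kernel (enn2real (inverse r)) x \<omega>)) \<le>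
      ennreal (2 * C) *
      ennreal (\<Sum>j\<in>J. 2 powr j * real (card {x. norm (f x) > 2 powr j}) powr (1 / P))"
    using dyadic_bound[OF r f less_imp_le[OF C(1)] C(2)] by blast
  note J(4)
  also have "ennreal (2 * C) * ennreal (\<Sum>j\<in>J. 2 powr j * real (card {x. norm (f x) > 2 powr j}) powr (1 / P)) \<le>
      ennreal (2 * C) * (ennreal (b / (b - 1)) * N f)"
    unfolding b_def N_def using p J by (intro mult_left_mono dyadic_le_Lp_norm) auto
  also have "\<dots> = ennreal (2 * C * (b / (b - 1))) * N f"
    using C b by (subst ennreal_mult) (auto simp: mult.assoc)
  finally show "Lp_norm \<nu> r (\<lambda>\<omega>. of_real (\<Sum>x | f x \<noteq> 0. norm (f x) * kernel (enn2real (inverse r)) x \<omega>)) \<le>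
      ennreal (2 * C * (b / (b - 1))) * N f" .
qed (use p eventually_in_ball in \<open>auto simp: N_def Lp_space_count_space intro!: Lp_norm_count_space_mono
      Lp_norm_tail_tendsto_0[where B = "\<lambda>n. {x. lev x \<le> n}", simplified]\<close>)

text \<open>On \<open>L\<^sup>1\<close> the constant 1 is obtained from the triangle inequality, without dyadic levels.\<close>

lemma extension_L1:
  assumes r: "1 \<le> r" and z: "Im z = delta (conj_exponent r)"
  defines "N \<equiv> Lp_norm (count_space UNIV :: 'v measure) 1"
  shows "(\<exists>T. helgason_fourier_extension q adj v0 z (Lp_space (count_space UNIV) 1) N r T) \<and>
    (\<forall>T. helgason_fourier_extension q adj v0 z (Lp_space (count_space UNIV) 1) N r T \<longrightarrow>
      (\<forall>f\<in>Lp_space (count_space UNIV) 1. Lp_norm \<nu> r (T f) \<le> ennreal 1 * N f))"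
proof (rule extension_of_positive_bound[OF r z])
  fix f :: "'v \<Rightarrow> complex" assume f: "finitely_supported f"
  define F where "F = {x. f x \<noteq> 0}"
  have F: "finite F"
    using f by (simp add: F_def finitely_supported_def)
  let ?k = "kernel (enn2real (inverse r))"
  have I: "(\<integral>\<^sup>+x. ennreal (norm (f x) powr 1) \<partial>count_space UNIV) = ennreal (\<Sum>x\<in>F. norm (f x))"
    using F by (subst nn_integral_count_space'[of F]) (auto simp: F_def)
  have N: "N f = ennreal (\<Sum>x\<in>F. norm (f x))"
    unfolding N_def Lp_norm_def Let_def enn2real_1 I by (simp add: sum_nonneg)
  have "Lp_norm \<nu> r (\<lambda>\<omega>. \<Sum>x\<in>F. complex_of_real (norm (f x)) * of_real (?k x \<omega>)) \<le>
      (\<Sum>x\<in>F. Lp_norm \<nu> r (\<lambda>\<omega>. complex_of_real (norm (f x)) * of_real (?k x \<omega>)))"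
    using F by (intro Lp_norm_sum_le r) auto
  also have "\<dots> \<le> (\<Sum>x\<in>F. ennreal (norm (f x)) * 1)"
  proof (rule sum_mono)
    fix x
    have "Lp_norm \<nu> r (\<lambda>\<omega>. complex_of_real (norm (f x)) * of_real (?k x \<omega>)) \<le>
        ennreal (norm (complex_of_real (norm (f x)))) * Lp_norm \<nu> r (\<lambda>\<omega>. of_real (?k x \<omega>))"
      by (intro Lp_norm_cmult_le r) auto
    also have "\<dots> \<le> ennreal (norm (f x)) * 1"
      by (intro mult_mono Lp_norm_kernel_le_1 r) auto
    finally show "Lp_norm \<nu> r (\<lambda>\<omega>. complex_of_real (norm (f x)) * of_real (?k x \<omega>)) \<le>
        ennreal (norm (f x)) * 1" .
  qed
  also have "\<dots> = ennreal 1 * N f"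
    by (simp add: N)
  finally show "Lp_norm \<nu> r (\<lambda>\<omega>. of_real (\<Sum>x | f x \<noteq> 0. norm (f x) * ?k x \<omega>)) \<le> ennreal 1 * N f"
    by (simp add: F_def)
qed (use eventually_in_ball Lp_norm_tail_tendsto_0[where B = "\<lambda>n. {x. lev x \<le> n}" and p = 1, simplified]
      in \<open>auto simp: N_def Lp_space_count_space intro!: Lp_norm_count_space_mono\<close>)

end

section \<open>The theorem\<close>

lemma conj_exponent_real:
  assumes "1 < p"
  shows "conj_exponent (ennreal p) = ennreal (1 / (1 - 1 / p))"
proof -
  have "inverse (ennreal p) = ennreal (1 / p)"
    using assms by (simp add: inverse_ennreal divide_inverse)
  then have "1 - inverse (ennreal p) = ennreal (1 - 1 / p)"
    using assms by (simp add: ennreal_minus flip: ennreal_1)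
  moreover have "0 < 1 - 1 / p"
    using assms by simp
  ultimately show ?thesis
    by (simp add: conj_exponent_def inverse_ennreal inverse_eq_divide)
qed

lemma less_conj_exponentD:
  assumes "1 \<le> p" "r < conj_exponent (ennreal p)" "r = ennreal \<rho>" "1 < \<rho>"
  shows "1 - 1 / p < 1 / \<rho>"
proof (cases "p = 1")
  case False
  with assms have p: "1 < p" by simp
  then have pos: "0 < 1 - 1 / p" by simp
  have "\<rho> < 1 / (1 - 1 / p)"
    using assms pos by (simp add: conj_exponent_real[OF p] ennreal_less_iff)
  then have "\<rho> * (1 - 1 / p) < 1"
    using pos by (simp add: less_divide_eq)
  then show ?thesis
    using assms(4) by (simp add: less_divide_eq mult.commute)
qed (use assms in simp)

lemma conj_exponent_1: "conj_exponent 1 = \<infinity>"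
  by (simp add: conj_exponent_def)

theorem theoremA:
  fixes q :: nat and adj :: "'v \<Rightarrow> 'v \<Rightarrow> bool" and v0 :: 'v and p :: real
  assumes "q \<ge> 2" and "homogeneous_tree q adj" and "1 \<le> p" and "p < 2"
  shows
    "(\<forall>r. ennreal p < r \<and> r < conj_exponent (ennreal p) \<longrightarrow>
        (\<exists>C::real. C > 0 \<and> (\<forall>z. Im z = delta (conj_exponent r) \<longrightarrow>
          (let S = Lp_space (count_space UNIV) (ennreal p);
               N = Lp_norm (count_space UNIV) (ennreal p) in
            (\<exists>T. helgason_fourier_extension q adj v0 z S N r T) \<and>
            (\<forall>T. helgason_fourier_extension q adj v0 z S N r T \<longrightarrow>
              (\<forall>f\<in>S. Lp_norm (boundary_measure q adj v0) r (T f) \<le> ennreal C * N f)))))) \<and>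
     (p = 1 \<longrightarrow> (\<forall>r. 1 \<le> r \<longrightarrow> (\<forall>z. Im z = delta (conj_exponent r) \<longrightarrow>
          (let S = Lp_space (count_space UNIV) 1;
               N = Lp_norm (count_space UNIV) 1 in
            (\<exists>T. helgason_fourier_extension q adj v0 z S N r T) \<and>
            (\<forall>T. helgason_fourier_extension q adj v0 z S N r T \<longrightarrow>
              (\<forall>f\<in>S. Lp_norm (boundary_measure q adj v0) r (T f) \<le> N f)))))) \<and>
     (\<exists>C::real. C > 0 \<and> (\<forall>r\<in>{ennreal p, conj_exponent (ennreal p)}.
        \<forall>z. Im z = delta (conj_exponent r) \<longrightarrow>
          (let S = lorentz_space p;
               N = lorentz_norm p in
            (\<exists>T. helgason_fourier_extension q adj v0 z S N r T) \<and>
            (\<forall>T. helgason_fourier_extension q adj v0 z S N r T \<longrightarrow>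
              (\<forall>f\<in>S. Lp_norm (boundary_measure q adj v0) r (T f) \<le> ennreal C * N f)))))"
proof -
  interpret rooted_tree q adj v0
    using assms by unfold_locales
  show ?thesis
  proof (intro conjI allI impI, goal_cases)
    case (1 r)
    then obtain \<rho> where \<rho>: "r = ennreal \<rho>" "p < \<rho>"
      using assms by (cases r) (auto simp: ennreal_less_iff)
    have r: "1 \<le> r"
      using \<rho> assms by simp
    have u: "1 - 1 / p < 1 / \<rho>"
      using 1 \<rho> assms by (intro less_conj_exponentD) auto
    then have "p < 1 / (1 - 1 / \<rho>)"
      using \<rho> assms by (simp add: field_simps)
    \<comment> \<open>an intermediate exponent whose restricted bound still holds for this \<open>r\<close>\<close>
    then obtain P where P: "p < P" "P < \<rho>" "P < 1 / (1 - 1 / \<rho>)"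
      using \<rho> dense[of p "min \<rho> (1 / (1 - 1 / \<rho>))"] by auto
    then have "1 - 1 / P < 1 / \<rho>"
      using \<rho> assms by (simp add: field_simps)
    then obtain C where C: "0 < C" "restricted_type r P C"
      using restricted_type_interior[of \<rho> P] P \<rho> assms by auto
    define b where "b = 2 powr (1 - p / P)"
    have "1 < b"
      unfolding b_def using P assms by (simp add: field_simps)
    then show ?case
      unfolding Let_def b_def using extension_Lp[OF r _ assms(3) P(1) C] C
      by (intro exI[of _ "2 * C * (2 powr (1 - p / P) / (2 powr (1 - p / P) - 1))"]) auto
  next
    case (2 r z)
    then show ?case
      unfolding Let_def using extension_L1[of r z] by simp
  next
    case 3
    have exponents: "1 \<le> r" if "r \<in> {ennreal p, conj_exponent (ennreal p)}" for r
    proof (cases "p = 1")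
      case True
      then show ?thesis
        using that conj_exponent_1 by auto
    next
      case False
      then show ?thesis
        using that assms conj_exponent_real[of p] by auto
    qed
    have "\<exists>C>0. restricted_type r p C" if "r \<in> {ennreal p, conj_exponent (ennreal p)}" for r
    proof (cases "p = 1")
      case True
      then show ?thesis
        using restricted_type_1[OF exponents[OF that]] by (intro exI[of _ 1]) simp
    next
      case False
      then have p: "1 < p" using assms by simp
      show ?thesis
      proof (cases "r = ennreal p")
        case True
        then show ?thesis
          using restricted_type_interior[of p p] p assms by (simp add: field_simps)
      next
        case False
        then have "r = ennreal (1 / (1 - 1 / p))"
          using that conj_exponent_real[OF p] by simp
        then show ?thesis
          using restricted_type_endpoint[of "1 / (1 - 1 / p)" p] p assms by (simp add: field_simps)
      qed
    qed
    then obtain C where C: "0 < C r" "restricted_type r p (C r)"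
      if "r \<in> {ennreal p, conj_exponent (ennreal p)}" for r
      by metis
    define D where "D = C (ennreal p) + C (conj_exponent (ennreal p))"
    have D: "0 < D"
      using C(1)[of "ennreal p"] C(1)[of "conj_exponent (ennreal p)"] by (simp add: D_def)
    have "restricted_type r p D" if "r \<in> {ennreal p, conj_exponent (ennreal p)}" for r
    proof -
      have "C r \<le> D"
        using that C(1)[of "ennreal p"] C(1)[of "conj_exponent (ennreal p)"] by (auto simp: D_def)
      then have "ennreal (C r * real n powr (1 / p)) \<le> ennreal (D * real n powr (1 / p))" for n
        by (intro ennreal_leI mult_right_mono) auto
      then show ?thesis
        using C(2)[OF that] unfolding restricted_type_def by (meson order_trans)
    qed
    then show ?case
      unfolding Let_def using extension_lorentz[OF exponents _ assms(3) D] D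
      by (intro exI[of _ "4 * D"] conjI ballI allI impI) auto
  qed
qed

end
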